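(* Let $A$ be an integral domain, $t$ an indeterminate over $A$, $p$ a prime ideal of $A$, and let $R:=A[t^{-1},pt,p^{(2)}t^2,\ldots,p^{(n)}t^n,\ldots]$ be the symbolic Rees algebra of $p$. Let $q$ be a prime ideal of $A$ containing $p$. Then the following lattice isomorphisms hold (all sets of primes being ordered by inclusion): (1) $\{Q\in\operatorname{Spec}(R)\mid Q\cap A[t^{-1}]=(q,t^{-1})\}\simeq \operatorname{Spec}\left(\dfrac{G(A_q)}{\frac{qA_q}{pA_q}G(A_q)}\right)$. (2) $\{P\in\operatorname{Spec}(R)\mid P\cap A[t^{-1}]=(p,t^{-1})\}\simeq \operatorname{Spec}(G(A_p))$.
   Context: For a prime ideal $p$ of a domain $A$ and $n\in\mathbb{Z}$, $p^{(n)}:=p^nA_p\cap A$ is the $n$th symbolic power of $p$ for $n\ge 1$, and $p^{(n)}=A$ for $n\leq 0$. The symbolic Rees algebra of $p$ is $\bigoplus_{n\in\mathbb{Z}}p^{(n)}t^n=A[t^{-1},p^{(1)}t,\ldots,p^{(n)}t^n,\ldots]\subseteq A[t,t^{-1}]$. Here $(q,t^{-1})$ denotes the (prime) ideal of $A[t^{-1}]$ generated by $q$ and $t^{-1}$. For a prime ideal $q\supseteq p$ of $A$, $G(A_q):=\bigoplus_{n\geq 0}(pA_q)^{(n)}/(pA_q)^{(n+1)}$, the associated graded ring of $A_q$ with respect to the filtration of symbolic powers $(pA_q)^{(n)}$ of the prime ideal $pA_q$ of $A_q$. Its degree-zero part is $A_q/pA_q$, and $\frac{qA_q}{pA_q}G(A_q)$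 is the ideal of $G(A_q)$ generated by the ideal $qA_q/pA_q$ of that degree-zero part. *)

theory Defs
  imports "HOL-Algebra.QuotRing" "HOL-Algebra.Ideal_Product" "HOL-Algebra.Generated_Rings"
begin

definition Spec :: "('a, 'b) ring_scheme \<Rightarrow> 'a set set"
  where "Spec R = {P. primeideal P R}"

text \<open>Isomorphism of families of sets ordered by inclusion.  Such a bijection preserves
  and reflects every supremum and infimum that exists in the two ordered sets.\<close>

definition inclusion_isomorphic :: "'a set set \<Rightarrow> 'b set set \<Rightarrow> bool"
  where "inclusion_isomorphic \<A> \<B> \<longleftrightarrow>
    (\<exists>f. bij_betw f \<A> \<B> \<and> (\<forall>P\<in>\<A>. \<forall>Q\<in>\<A>. P \<subseteq> Q \<longleftrightarrow> f P \<subseteq> f Q))"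

text \<open>Here \<open>S\<close> is a multiplicatively closed subset of the commutative ring \<open>A\<close>, and
  \<open>fraction A S a s\<close> is the fraction \<open>a/s\<close>, represented as a set of pairs.\<close>

definition fraction_rel :: "('a, 'b) ring_scheme \<Rightarrow> 'a set \<Rightarrow> (('a \<times> 'a) \<times> ('a \<times> 'a)) set"
  where "fraction_rel A S =
    {((a, s), (b, t)) | a s b t. a \<in> carrier A \<and> s \<in> S \<and> b \<in> carrier A \<and> t \<in> S \<and>
       (\<exists>u\<in>S. u \<otimes>\<^bsub>A\<^esub> ((a \<otimes>\<^bsub>A\<^esub> t) \<ominus>\<^bsub>A\<^esub> (b \<otimes>\<^bsub>A\<^esub> s)) = \<zero>\<^bsub>A\<^esub>)}"

definition fraction :: "('a, 'b) ring_scheme \<Rightarrow> 'a set \<Rightarrow> 'a \<Rightarrow> 'a \<Rightarrow> ('a \<times> 'a) set"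
  where "fraction A S a s = fraction_rel A S `` {(a, s)}"

text \<open>The operations are unions over all representatives; all members of each union are
  the same fraction.\<close>

definition localization :: "('a, 'b) ring_scheme \<Rightarrow> 'a set \<Rightarrow> ('a \<times> 'a) set ring"
  where "localization A S =
    \<lparr>carrier = (carrier A \<times> S) // fraction_rel A S,
     mult = (\<lambda>U V. \<Union>(a, s)\<in>U. \<Union>(b, t)\<in>V. fraction A S (a \<otimes>\<^bsub>A\<^esub> b) (s \<otimes>\<^bsub>A\<^esub> t)),
     one = fraction A S \<one>\<^bsub>A\<^esub> \<one>\<^bsub>A\<^esub>,
     zero = fraction A S \<zero>\<^bsub>A\<^esub> \<one>\<^bsub>A\<^esub>,
     add = (\<lambda>U V. \<Union>(a, s)\<in>U. \<Union>(b, t)\<in>V.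
              fraction A S ((a \<otimes>\<^bsub>A\<^esub> t) \<oplus>\<^bsub>A\<^esub> (b \<otimes>\<^bsub>A\<^esub> s)) (s \<otimes>\<^bsub>A\<^esub> t))\<rparr>"

definition local_at :: "('a, 'b) ring_scheme \<Rightarrow> 'a set \<Rightarrow> ('a \<times> 'a) set ring"
  where "local_at A q = localization A (carrier A - q)"

definition to_local :: "('a, 'b) ring_scheme \<Rightarrow> 'a set \<Rightarrow> 'a \<Rightarrow> ('a \<times> 'a) set"
  where "to_local A q a = fraction A (carrier A - q) a \<one>\<^bsub>A\<^esub>"

text \<open>The extension \<open>I A\<^sub>q\<close> of an ideal \<open>I\<close> of \<open>A\<close>.\<close>

definition local_ext :: "('a, 'b) ring_scheme \<Rightarrow> 'a set \<Rightarrow> 'a set \<Rightarrow> ('a \<times> 'a) set set"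
  where "local_ext A q I = Idl\<^bsub>local_at A q\<^esub> (to_local A q ` I)"

text \<open>\<open>p\<^sup>n A\<^sub>p \<inter> A\<close> is the preimage of \<open>p\<^sup>n A\<^sub>p\<close> under the canonical map; the power \<open>p\<^sup>n\<close> is
  taken in the monoid of ideals of \<open>A\<close> under the ideal product.\<close>

definition symbolic_power :: "('a, 'b) ring_scheme \<Rightarrow> 'a set \<Rightarrow> int \<Rightarrow> 'a set"
  where "symbolic_power A p n =
    (if n \<le> 0 then carrier A
     else {a \<in> carrier A. to_local A p a \<in> local_ext A p (p [^]\<^bsub>ideals_set A\<^esub> nat n)})"

text \<open>\<open>A[t, t\<^sup>-\<^sup>1]\<close>: a Laurent polynomial is its coefficient function.\<close>

definition Laurent :: "('a, 'b) ring_scheme \<Rightarrow> (int \<Rightarrow> 'a) ring"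
  where "Laurent A =
    \<lparr>carrier = {f. range f \<subseteq> carrier A \<and> finite {n. f n \<noteq> \<zero>\<^bsub>A\<^esub>}},
     mult = (\<lambda>f g n. \<Oplus>\<^bsub>A\<^esub>i\<in>{i. f i \<noteq> \<zero>\<^bsub>A\<^esub>}. f i \<otimes>\<^bsub>A\<^esub> g (n - i)),
     one = (\<lambda>n. if n = 0 then \<one>\<^bsub>A\<^esub> else \<zero>\<^bsub>A\<^esub>),
     zero = (\<lambda>n. \<zero>\<^bsub>A\<^esub>),
     add = (\<lambda>f g n. f n \<oplus>\<^bsub>A\<^esub> g n)\<rparr>"

text \<open>The term \<open>a t\<^sup>n\<close>.\<close>

definition lterm :: "('a, 'b) ring_scheme \<Rightarrow> 'a \<Rightarrow> int \<Rightarrow> (int \<Rightarrow> 'a)"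
  where "lterm A a n = (\<lambda>k. if k = n then a else \<zero>\<^bsub>A\<^esub>)"

text \<open>\<open>A[H]\<close>, the subring of \<open>A[t, t\<^sup>-\<^sup>1]\<close> generated by \<open>A\<close> and \<open>H\<close>.\<close>

definition adjoin :: "('a, 'b) ring_scheme \<Rightarrow> (int \<Rightarrow> 'a) set \<Rightarrow> (int \<Rightarrow> 'a) ring"
  where "adjoin A H =
    (Laurent A)\<lparr>carrier := generate_ring (Laurent A) ((\<lambda>a. lterm A a 0) ` carrier A \<union> H)\<rparr>"

definition poly_t_inv :: "('a, 'b) ring_scheme \<Rightarrow> (int \<Rightarrow> 'a) ring"
  where "poly_t_inv A = adjoin A {lterm A \<one>\<^bsub>A\<^esub> (-1)}"

definition symbolic_Rees :: "('a, 'b) ring_scheme \<Rightarrow> 'a set \<Rightarrow> (int \<Rightarrow> 'a) ring"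
  where "symbolic_Rees A p =
    adjoin A ({lterm A \<one>\<^bsub>A\<^esub> (-1)} \<union> {lterm A a n | a n. 1 \<le> n \<and> a \<in> symbolic_power A p n})"

text \<open>The ideal \<open>(q, t\<^sup>-\<^sup>1)\<close> of \<open>A[t\<^sup>-\<^sup>1]\<close>.\<close>

definition q_t_inv :: "('a, 'b) ring_scheme \<Rightarrow> 'a set \<Rightarrow> (int \<Rightarrow> 'a) set"
  where "q_t_inv A q =
    Idl\<^bsub>poly_t_inv A\<^esub> ((\<lambda>a. lterm A a 0) ` q \<union> {lterm A \<one>\<^bsub>A\<^esub> (-1)})"

text \<open>\<open>F\<close> is a descending multiplicative filtration of \<open>B\<close> by ideals, with \<open>F 0 = B\<close>.  An element
  of \<open>\<Oplus>\<^sub>n F n / F (n + 1)\<close> is a finitely supported family of cosets.  The zero coset of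
  \<open>F n / F (n + 1)\<close> is the set \<open>F (n + 1)\<close>, and \<open>F n / F (n + 1)\<close> is an additive subgroup of
  \<open>B / F (n + 1)\<close>, in which the sum over \<open>i + j = n\<close> of the products of the classes of degree
  \<open>i\<close> and \<open>j\<close> is formed.\<close>

definition assoc_graded :: "('a, 'b) ring_scheme \<Rightarrow> (nat \<Rightarrow> 'a set) \<Rightarrow> (nat \<Rightarrow> 'a set) ring"
  where "assoc_graded B F =
    \<lparr>carrier = {x. (\<forall>n. \<exists>a\<in>F n. x n = F (Suc n) +>\<^bsub>B\<^esub> a) \<and> finite {n. x n \<noteq> F (Suc n)}},
     mult = (\<lambda>x y n. \<Oplus>\<^bsub>B Quot F (Suc n)\<^esub>i\<in>{..n}. rcoset_mult B (F (Suc n)) (x i) (y (n - i))),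
     one = (\<lambda>n. if n = 0 then F 1 +>\<^bsub>B\<^esub> \<one>\<^bsub>B\<^esub> else F (Suc n)),
     zero = (\<lambda>n. F (Suc n)),
     add = (\<lambda>x y n. x n <+>\<^bsub>B\<^esub> y n)\<rparr>"

text \<open>The filtration of \<open>A\<^sub>q\<close> by the symbolic powers of \<open>p A\<^sub>q\<close>, and the ring \<open>G(A\<^sub>q)\<close>.\<close>

definition symbolic_filtration ::
    "('a, 'b) ring_scheme \<Rightarrow> 'a set \<Rightarrow> 'a set \<Rightarrow> nat \<Rightarrow> ('a \<times> 'a) set set"
  where "symbolic_filtration A p q n = symbolic_power (local_at A q) (local_ext A q p) (int n)"

definition symbolic_G ::
    "('a, 'b) ring_scheme \<Rightarrow> 'a set \<Rightarrow> 'a set \<Rightarrow> (nat \<Rightarrow> ('a \<times> 'a) set set) ring"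
  where "symbolic_G A p q = assoc_graded (local_at A q) (symbolic_filtration A p q)"

text \<open>The ideal of \<open>G(A\<^sub>q)\<close> generated by the ideal \<open>q A\<^sub>q / p A\<^sub>q\<close> of its degree-zero part
  \<open>A\<^sub>q / (p A\<^sub>q)\<^sup>(\<^sup>1\<^sup>) = A\<^sub>q / p A\<^sub>q\<close>.\<close>

definition symbolic_G_ideal ::
    "('a, 'b) ring_scheme \<Rightarrow> 'a set \<Rightarrow> 'a set \<Rightarrow> (nat \<Rightarrow> ('a \<times> 'a) set set) set"
  where "symbolic_G_ideal A p q = Idl\<^bsub>symbolic_G A p q\<^esub>
    {(\<lambda>n. if n = 0 then symbolic_filtration A p q 1 +>\<^bsub>local_at A q\<^esub> a
          else symbolic_filtration A p q (Suc n)) | a. a \<in> local_ext A q q}"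

end

theory Submission
  imports Defs
begin

text \<open>Let \<open>R\<close> be the symbolic Rees algebra.  Taking the initial forms in \<open>G(A_q)\<close> of the coefficients
  of nonnegative degree is a ring homomorphism \<open>\<phi>\<close> from \<open>R\<close> to \<open>G(A_q)\<close>.  Its kernel is the ideal
  generated by \<open>1/t\<close>, because the symbolic powers of \<open>p A_q\<close> contract to those of \<open>p\<close>.  The elements
  of \<open>A - q\<close> become units in \<open>G(A_q)\<close>, and every element of \<open>G(A_q)\<close> is a fraction with
  numerator in the image of \<open>\<phi>\<close> and denominator in \<open>A - q\<close>.  Thus \<open>G(A_q)\<close> is the localization of
  \<open>R/(1/t)\<close> at \<open>A - q\<close>, and its primes are those of \<open>R\<close> that contain \<open>1/t\<close> and avoid
  \<open>A - q\<close>.  A prime of \<open>R\<close> lies over \<open>(q, 1/t)\<close> iff it contains \<open>1/t\<close> and \<open>q\<close> and avoids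
  \<open>A - q\<close>; containing \<open>q\<close> is what the quotient by \<open>(q A_q/p A_q) G(A_q)\<close> encodes, and for \<open>q = p\<close>
  it is automatic since \<open>p\<close> vanishes in degree zero of \<open>G(A_p)\<close>.\<close>

section \<open>Localization\<close>

text \<open>Both isomorphisms come from one correspondence theorem, for homomorphisms that become
  surjective once denominators with invertible images are cleared. It is applied to \<phi>, and to
  \<phi> followed by the quotient map. The obstacle is that an element of G(A_q) is a bare family of
  cosets of varying ideals, in which little can be computed. So \<phi> is factored through the Rees
  ring of the symbolic filtration of A_q: coefficients are localized first, initial forms are taken
  second. The second map is onto, so ring axioms, units and denominators of G(A_q) are all handled
  among Laurent polynomials. The filtrations are indexed by all integers, because the Rees rings
  contain 1/t; each such ring is then cut out of the Laurent polynomials by one condition per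
  coefficient. The filtration that is A in degrees up to 0 and zero above gives A[1/t] in the same
  way. Symbolic powers contract well because A - q lies in A - p: every denominator of A_q is a
  multiplier that the symbolic powers of p ignore.\<close>

locale mult_subset = cring A for A (structure) +
  fixes S
  assumes S_subset: "S \<subseteq> carrier A"
    and S_one: "\<one> \<in> S"
    and S_mult: "\<lbrakk>s \<in> S; t \<in> S\<rbrakk> \<Longrightarrow> s \<otimes> t \<in> S"
begin

lemma S_carr [simp]: "s \<in> S \<Longrightarrow> s \<in> carrier A"
  using S_subset by auto

text \<open>Without the difference of the definition, every equality of fractions is an equation
  between products, where AC rewriting applies.\<close>

lemma fraction_rel_iff:
  "((a, s), (b, t)) \<in> fraction_rel A S \<longleftrightarrow>
    a \<in> carrier A \<and> s \<in> S \<and> b \<in> carrier A \<and> t \<in> S \<and>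
    (\<exists>u\<in>S. u \<otimes> (a \<otimes> t) = u \<otimes> (b \<otimes> s))"
proof -
  have "u \<otimes> (a \<otimes> t \<ominus> b \<otimes> s) = \<zero> \<longleftrightarrow> u \<otimes> (a \<otimes> t) = u \<otimes> (b \<otimes> s)"
    if "u \<in> S" "a \<in> carrier A" "b \<in> carrier A" "s \<in> S" "t \<in> S" for u
  proof -
    have "u \<otimes> (a \<otimes> t \<ominus> b \<otimes> s) = u \<otimes> (a \<otimes> t) \<ominus> u \<otimes> (b \<otimes> s)"
      using that by (simp add: r_distr minus_eq r_minus)
    then show ?thesis using that by simp
  qed
  then show ?thesis by (auto simp: fraction_rel_def)
qed

lemma fraction_rel_trans:
  assumes "((a, s), (b, t)) \<in> fraction_rel A S" "((b, t), (c, w)) \<in> fraction_rel A S"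
  shows "((a, s), (c, w)) \<in> fraction_rel A S"
proof -
  obtain u v where *: "a \<in> carrier A" "b \<in> carrier A" "c \<in> carrier A" "s \<in> S" "t \<in> S" "w \<in> S"
    "u \<in> S" "v \<in> S" "u \<otimes> (a \<otimes> t) = u \<otimes> (b \<otimes> s)" "v \<otimes> (b \<otimes> w) = v \<otimes> (c \<otimes> t)"
    using assms by (auto simp: fraction_rel_iff)
  note [simp] = *(1-8)
  \<comment> \<open>\<open>u\<close> and \<open>v\<close> come from the two hypotheses;
    \<open>t\<close> joins them because both equations carry this middle denominator and
    \<open>A\<close> need not allow cancelling it.\<close>
  have "(u \<otimes> v \<otimes> t) \<otimes> (a \<otimes> w) = (v \<otimes> w) \<otimes> (u \<otimes> (a \<otimes> t))" by (simp add: m_ac)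
  also have "\<dots> = (u \<otimes> s) \<otimes> (v \<otimes> (b \<otimes> w))"
    by (subst *(9)) (simp add: m_ac)
  also have "\<dots> = (u \<otimes> v \<otimes> t) \<otimes> (c \<otimes> s)"
    by (subst *(10)) (simp add: m_ac)
  finally show ?thesis using S_mult by (auto simp: fraction_rel_iff intro!: bexI[of _ "u \<otimes> v \<otimes> t"])
qed

lemma equiv_fraction_rel: "equiv (carrier A \<times> S) (fraction_rel A S)"
proof (rule equivI)
  show "fraction_rel A S \<subseteq> (carrier A \<times> S) \<times> (carrier A \<times> S)"
    by (auto simp: fraction_rel_def)
  show "refl_on (carrier A \<times> S) (fraction_rel A S)"
    using S_one by (auto simp: refl_on_def fraction_rel_iff)
  show "sym (fraction_rel A S)"
    by (rule symI) (auto simp: fraction_rel_iff, metis)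
  show "trans (fraction_rel A S)"
    by (rule transI) (auto dest: fraction_rel_trans)
qed

lemma fraction_eq_iff:
  assumes "a \<in> carrier A" "s \<in> S" "b \<in> carrier A" "t \<in> S"
  shows "fraction A S a s = fraction A S b t \<longleftrightarrow> (\<exists>u\<in>S. u \<otimes> (a \<otimes> t) = u \<otimes> (b \<otimes> s))"
  using eq_equiv_class_iff[OF equiv_fraction_rel, of "(a, s)" "(b, t)"] assms
  by (simp add: fraction_def fraction_rel_iff)

lemma fraction_eqI:
  assumes "a \<in> carrier A" "s \<in> S" "b \<in> carrier A" "t \<in> S" "a \<otimes> t = b \<otimes> s"
  shows "fraction A S a s = fraction A S b t"
  using assms S_one by (auto simp: fraction_eq_iff)

lemma fraction_closed [simp]:
  "\<lbrakk>a \<in> carrier A; s \<in> S\<rbrakk> \<Longrightarrow> fraction A S a s \<in> carrier (localization A S)"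
  by (auto simp: localization_def fraction_def intro: quotientI)

lemma fraction_cases:
  assumes "x \<in> carrier (localization A S)"
  obtains a s where "a \<in> carrier A" "s \<in> S" "x = fraction A S a s"
  using assms by (auto simp: localization_def fraction_def elim!: quotientE)

lemma fraction_self: "\<lbrakk>a \<in> carrier A; s \<in> S\<rbrakk> \<Longrightarrow> (a, s) \<in> fraction A S a s"
  using S_one by (auto simp: fraction_def fraction_rel_iff)

lemma mem_fraction_iff:
  assumes "a \<in> carrier A" "s \<in> S"
  shows "(b, t) \<in> fraction A S a s \<longleftrightarrow>
    b \<in> carrier A \<and> t \<in> S \<and> fraction A S b t = fraction A S a s"
proof -
  have "(b, t) \<in> fraction A S a s \<longleftrightarrow>
    b \<in> carrier A \<and> t \<in> S \<and> fraction A S a s = fraction A S b t"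
    using assms fraction_rel_iff[of a s b t] fraction_eq_iff[of a s b t]
    by (auto simp: fraction_def[of A S a s])
  then show ?thesis by metis
qed

text \<open>The operations of \<open>localization\<close> are unions over all representatives. A
  union of equal sets over a nonempty index set is their common value, so well-definedness is
  reduced to comparing two choices of representatives.\<close>

lemma UN_fraction_eq:
  assumes "a \<in> carrier A" "s \<in> S" "b \<in> carrier A" "t \<in> S"
    and "\<And>a' s' b' t'. \<lbrakk>a' \<in> carrier A; s' \<in> S; b' \<in> carrier A; t' \<in> S;
      fraction A S a' s' = fraction A S a s; fraction A S b' t' = fraction A S b t\<rbrakk>
      \<Longrightarrow> F a' s' b' t' = F a s b t"
  shows "(\<Union>(a, s)\<in>fraction A S a s. \<Union>(b, t)\<in>fraction A S b t. F a s b t) = F a s b t"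
proof -
  have inner: "(\<Union>(b, t)\<in>fraction A S b t. F a' s' b t) = F a s b t"
    if "(a', s') \<in> fraction A S a s" for a' s'
  proof (rule SUP_eq_const)
    show "fraction A S b t \<noteq> {}" using fraction_self[OF assms(3,4)] by auto
    fix r assume "r \<in> fraction A S b t"
    then obtain b' t' where r: "r = (b', t')" "(b', t') \<in> fraction A S b t"
      by (cases r) simp
    have "F a' s' b' t' = F a s b t"
      by (rule assms(5)) (use that r assms(1-4) in \<open>simp_all add: mem_fraction_iff\<close>)
    then show "(case r of (b, t) \<Rightarrow> F a' s' b t) = F a s b t"
      using r by simp
  qed
  show ?thesis
  proof (rule SUP_eq_const)
    show "fraction A S a s \<noteq> {}" using fraction_self[OF assms(1,2)] by auto
    fix r assume "r \<in> fraction A S a s"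
    then show "(case r of (a, s) \<Rightarrow> \<Union>(b, t)\<in>fraction A S b t. F a s b t) = F a s b t"
      by (cases r) (simp add: inner)
  qed
qed

lemma localization_mult:
  assumes "a \<in> carrier A" "s \<in> S" "b \<in> carrier A" "t \<in> S"
  shows "fraction A S a s \<otimes>\<^bsub>localization A S\<^esub> fraction A S b t = fraction A S (a \<otimes> b) (s \<otimes> t)"
proof -
  have "fraction A S (a' \<otimes> b') (s' \<otimes> t') = fraction A S (a \<otimes> b) (s \<otimes> t)"
    if *: "a' \<in> carrier A" "s' \<in> S" "b' \<in> carrier A" "t' \<in> S"
      "fraction A S a' s' = fraction A S a s" "fraction A S b' t' = fraction A S b t"
    for a' s' b' t'
  proof -
    note [simp] = *(1-4) assms
    obtain u v where uv: "u \<in> S" "v \<in> S" "u \<otimes> (a' \<otimes> s) = u \<otimes> (a \<otimes> s')"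
      "v \<otimes> (b' \<otimes> t) = v \<otimes> (b \<otimes> t')"
      using * by (auto simp: fraction_eq_iff)
    note [simp] = uv(1,2)
    have "(u \<otimes> v) \<otimes> ((a' \<otimes> b') \<otimes> (s \<otimes> t)) = (u \<otimes> (a' \<otimes> s)) \<otimes> (v \<otimes> (b' \<otimes> t))"
      by (simp add: m_ac)
    also have "\<dots> = (u \<otimes> v) \<otimes> ((a \<otimes> b) \<otimes> (s' \<otimes> t'))"
      by (simp add: uv(3,4)) (simp add: m_ac)
    finally show ?thesis
      by (subst fraction_eq_iff) (auto simp: S_mult intro!: bexI[of _ "u \<otimes> v"])
  qed
  then have "(\<Union>(a, s)\<in>fraction A S a s. \<Union>(b, t)\<in>fraction A S b t. fraction A S (a \<otimes> b) (s \<otimes> t)) =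
      fraction A S (a \<otimes> b) (s \<otimes> t)"
    by (rule UN_fraction_eq[where F = "\<lambda>a s b t. fraction A S (a \<otimes> b) (s \<otimes> t)", OF assms])
  then show ?thesis by (simp add: localization_def)
qed

lemma localization_add:
  assumes "a \<in> carrier A" "s \<in> S" "b \<in> carrier A" "t \<in> S"
  shows "fraction A S a s \<oplus>\<^bsub>localization A S\<^esub> fraction A S b t =
    fraction A S (a \<otimes> t \<oplus> b \<otimes> s) (s \<otimes> t)"
proof -
  have "fraction A S (a' \<otimes> t' \<oplus> b' \<otimes> s') (s' \<otimes> t') = fraction A S (a \<otimes> t \<oplus> b \<otimes> s) (s \<otimes> t)"
    if *: "a' \<in> carrier A" "s' \<in> S" "b' \<in> carrier A" "t' \<in> S"
      "fraction A S a' s' = fraction A S a s" "fraction A S b' t' = fraction A S b t"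
    for a' s' b' t'
  proof -
    note [simp] = *(1-4) assms
    obtain u v where uv: "u \<in> S" "v \<in> S" "u \<otimes> (a' \<otimes> s) = u \<otimes> (a \<otimes> s')"
      "v \<otimes> (b' \<otimes> t) = v \<otimes> (b \<otimes> t')"
      using * by (auto simp: fraction_eq_iff)
    note [simp] = uv(1,2)
    have "(u \<otimes> v) \<otimes> ((a' \<otimes> t' \<oplus> b' \<otimes> s') \<otimes> (s \<otimes> t)) =
        (u \<otimes> (a' \<otimes> s)) \<otimes> (v \<otimes> (t \<otimes> t')) \<oplus> (v \<otimes> (b' \<otimes> t)) \<otimes> (u \<otimes> (s \<otimes> s'))"
      by (simp add: l_distr r_distr m_ac)
    also have "\<dots> = (u \<otimes> v) \<otimes> ((a \<otimes> t \<oplus> b \<otimes> s) \<otimes> (s' \<otimes> t'))"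
      by (simp add: uv(3,4)) (simp add: l_distr r_distr m_ac)
    finally show ?thesis
      by (subst fraction_eq_iff) (auto simp: S_mult intro!: bexI[of _ "u \<otimes> v"])
  qed
  then have "(\<Union>(a, s)\<in>fraction A S a s. \<Union>(b, t)\<in>fraction A S b t. fraction A S (a \<otimes> t \<oplus> b \<otimes> s) (s \<otimes> t)) =
      fraction A S (a \<otimes> t \<oplus> b \<otimes> s) (s \<otimes> t)"
    by (rule UN_fraction_eq[where F = "\<lambda>a s b t. fraction A S (a \<otimes> t \<oplus> b \<otimes> s) (s \<otimes> t)", OF assms])
  then show ?thesis by (simp add: localization_def)
qed

lemma common_denominator:
  assumes "x \<in> carrier (localization A S)" "y \<in> carrier (localization A S)"
  obtains a b s where "a \<in> carrier A" "b \<in> carrier A" "s \<in> S"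
    "x = fraction A S a s" "y = fraction A S b s"
proof -
  obtain a s b t where *: "a \<in> carrier A" "s \<in> S" "x = fraction A S a s"
    "b \<in> carrier A" "t \<in> S" "y = fraction A S b t"
    using assms by (metis fraction_cases)
  have "fraction A S a s = fraction A S (a \<otimes> t) (s \<otimes> t)"
    using * by (intro fraction_eqI) (simp_all add: S_mult m_ac)
  moreover have "fraction A S b t = fraction A S (b \<otimes> s) (s \<otimes> t)"
    using * by (intro fraction_eqI) (simp_all add: S_mult m_ac)
  ultimately have "x = fraction A S (a \<otimes> t) (s \<otimes> t)" "y = fraction A S (b \<otimes> s) (s \<otimes> t)"
    using * by simp_all
  then show ?thesis using * S_mult that[of "a \<otimes> t" "b \<otimes> s" "s \<otimes> t"] by simp
qed

lemma localization_add_same: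
  assumes "a \<in> carrier A" "b \<in> carrier A" "s \<in> S"
  shows "fraction A S a s \<oplus>\<^bsub>localization A S\<^esub> fraction A S b s = fraction A S (a \<oplus> b) s"
proof -
  have "fraction A S (a \<otimes> s \<oplus> b \<otimes> s) (s \<otimes> s) = fraction A S (a \<oplus> b) s"
    using assms by (intro fraction_eqI) (simp_all add: S_mult l_distr m_assoc)
  then show ?thesis using assms by (simp add: localization_add)
qed

lemma localization_one: "\<one>\<^bsub>localization A S\<^esub> = fraction A S \<one> \<one>"
  by (simp add: localization_def)

lemma localization_zero: "\<zero>\<^bsub>localization A S\<^esub> = fraction A S \<zero> \<one>"
  by (simp add: localization_def)

lemma fraction_zero: "s \<in> S \<Longrightarrow> fraction A S \<zero> s = \<zero>\<^bsub>localization A S\<^esub>"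
  unfolding localization_zero using S_one by (intro fraction_eqI) auto

lemma localization_cring: "cring (localization A S)"
proof (rule cringI)
  let ?L = "localization A S"
  note simps = localization_add localization_mult localization_one localization_zero S_mult S_one
  show "abelian_group ?L"
  proof (rule abelian_groupI)
    fix x y z assume "x \<in> carrier ?L" "y \<in> carrier ?L" "z \<in> carrier ?L"
    then obtain a s b t c u where *: "a \<in> carrier A" "s \<in> S" "x = fraction A S a s"
      "b \<in> carrier A" "t \<in> S" "y = fraction A S b t" "c \<in> carrier A" "u \<in> S" "z = fraction A S c u"
      by (metis fraction_cases)
    then show "x \<oplus>\<^bsub>?L\<^esub> y \<in> carrier ?L" by (simp add: simps)
    show "x \<oplus>\<^bsub>?L\<^esub> y \<oplus>\<^bsub>?L\<^esub> z = x \<oplus>\<^bsub>?L\<^esub> (y \<oplus>\<^bsub>?L\<^esub> z)"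
      using * by (simp add: simps) (simp add: l_distr r_distr a_ac m_ac)
    show "x \<oplus>\<^bsub>?L\<^esub> y = y \<oplus>\<^bsub>?L\<^esub> x"
      using * by (simp add: simps) (simp add: a_ac m_ac)
    show "\<zero>\<^bsub>?L\<^esub> \<oplus>\<^bsub>?L\<^esub> x = x" using * by (simp add: simps)
    have "fraction A S (\<ominus> a) s \<oplus>\<^bsub>?L\<^esub> x = \<zero>\<^bsub>?L\<^esub>"
      using * by (simp add: localization_add_same l_neg fraction_zero)
    then show "\<exists>y\<in>carrier ?L. y \<oplus>\<^bsub>?L\<^esub> x = \<zero>\<^bsub>?L\<^esub>"
      using * by (intro bexI[of _ "fraction A S (\<ominus> a) s"]) simp_all
  qed (simp add: simps)
  show "Group.comm_monoid ?L"
  proof (rule comm_monoidI)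
    fix x y z assume "x \<in> carrier ?L" "y \<in> carrier ?L" "z \<in> carrier ?L"
    then obtain a s b t c u where *: "a \<in> carrier A" "s \<in> S" "x = fraction A S a s"
      "b \<in> carrier A" "t \<in> S" "y = fraction A S b t" "c \<in> carrier A" "u \<in> S" "z = fraction A S c u"
      by (metis fraction_cases)
    then show "x \<otimes>\<^bsub>?L\<^esub> y \<in> carrier ?L" by (simp add: simps)
    show "x \<otimes>\<^bsub>?L\<^esub> y \<otimes>\<^bsub>?L\<^esub> z = x \<otimes>\<^bsub>?L\<^esub> (y \<otimes>\<^bsub>?L\<^esub> z)"
      using * by (simp add: simps m_ac)
    show "x \<otimes>\<^bsub>?L\<^esub> y = y \<otimes>\<^bsub>?L\<^esub> x"
      using * by (simp add: simps m_ac)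
    show "\<one>\<^bsub>?L\<^esub> \<otimes>\<^bsub>?L\<^esub> x = x" using * by (simp add: simps)
  qed (simp add: simps)
  fix x y z assume "x \<in> carrier ?L" "y \<in> carrier ?L" "z \<in> carrier ?L"
  then obtain a b s c u where *: "a \<in> carrier A" "b \<in> carrier A" "s \<in> S" "c \<in> carrier A" "u \<in> S"
    "x = fraction A S a s" "y = fraction A S b s" "z = fraction A S c u"
    by (metis common_denominator fraction_cases)
  then show "(x \<oplus>\<^bsub>?L\<^esub> y) \<otimes>\<^bsub>?L\<^esub> z = x \<otimes>\<^bsub>?L\<^esub> z \<oplus>\<^bsub>?L\<^esub> y \<otimes>\<^bsub>?L\<^esub> z"
    by (simp add: localization_add_same localization_mult S_mult l_distr)
qed

lemma fraction_one_ring_hom: "(\<lambda>a. fraction A S a \<one>) \<in> ring_hom A (localization A S)"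
  using S_one
  by (intro ring_hom_memI) (simp_all add: localization_mult localization_add localization_one)

lemma fraction_mult_inverse:
  "s \<in> S \<Longrightarrow> fraction A S s \<one> \<otimes>\<^bsub>localization A S\<^esub> fraction A S \<one> s = \<one>\<^bsub>localization A S\<^esub>"
  using S_one by (simp add: localization_mult localization_one) (rule fraction_eqI, simp_all)

text \<open>For an ideal \<open>I\<close>, common denominators make this set closed under addition,
  so no sums of generators are needed; \<open>genideal_image_eq_ext\<close> identifies it with the
  generated ideal.\<close>

definition ext :: "'a set \<Rightarrow> ('a \<times> 'a) set set"
  where "ext I = {fraction A S a s | a s. a \<in> I \<and> s \<in> S}"

lemma fraction_mem_ext: "\<lbrakk>a \<in> I; s \<in> S\<rbrakk> \<Longrightarrow> fraction A S a s \<in> ext I"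
  by (auto simp: ext_def)

lemma ext_cases:
  assumes "x \<in> ext I"
  obtains a s where "a \<in> I" "s \<in> S" "x = fraction A S a s"
  using assms by (auto simp: ext_def)

text \<open>Membership in the extension is witnessed by some representative with numerator in
  \<open>I\<close>; the factor \<open>u\<close> is the price of testing an arbitrary one.\<close>

lemma fraction_mem_ext_iff:
  assumes "ideal I A" "b \<in> carrier A" "t \<in> S"
  shows "fraction A S b t \<in> ext I \<longleftrightarrow> (\<exists>u\<in>S. u \<otimes> b \<in> I)"
proof
  interpret I: ideal I A by fact
  assume "fraction A S b t \<in> ext I"
  then obtain a s where "a \<in> I" "s \<in> S" "fraction A S b t = fraction A S a s"
    by (auto simp: ext_def)
  then obtain u where u: "u \<in> S" "u \<otimes> (b \<otimes> s) = u \<otimes> (a \<otimes> t)"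
    using assms by (auto simp: fraction_eq_iff)
  have "(u \<otimes> s) \<otimes> b = u \<otimes> (a \<otimes> t)"
    using u assms \<open>s \<in> S\<close> by (metis S_carr m_assoc m_comm)
  also have "\<dots> \<in> I" using u assms \<open>a \<in> I\<close> by (simp add: I.I_l_closed I.I_r_closed)
  finally show "\<exists>u\<in>S. u \<otimes> b \<in> I" using u \<open>s \<in> S\<close> S_mult by blast
next
  assume "\<exists>u\<in>S. u \<otimes> b \<in> I"
  then obtain u where u: "u \<in> S" "u \<otimes> b \<in> I" by auto
  moreover have "fraction A S b t = fraction A S (u \<otimes> b) (u \<otimes> t)"
    using u assms by (intro fraction_eqI) (auto simp: S_mult m_ac)
  ultimately show "fraction A S b t \<in> ext I" using assms S_mult by (simp add: fraction_mem_ext)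
qed

lemma ext_subset: "I \<subseteq> carrier A \<Longrightarrow> ext I \<subseteq> carrier (localization A S)"
  by (auto simp: ext_def)

lemma ext_ideal:
  assumes "ideal I A"
  shows "ideal (ext I) (localization A S)"
proof -
  interpret I: ideal I A by fact
  interpret L: cring "localization A S" by (rule localization_cring)
  have mult: "x \<otimes>\<^bsub>localization A S\<^esub> y \<in> ext I"
    if "y \<in> ext I" "x \<in> carrier (localization A S)" for x y
  proof -
    from that obtain a s b t where *: "a \<in> I" "s \<in> S" "b \<in> carrier A" "t \<in> S"
      "y = fraction A S a s" "x = fraction A S b t"
      by (auto simp: ext_def elim: fraction_cases)
    then have "x \<otimes>\<^bsub>localization A S\<^esub> y = fraction A S (b \<otimes> a) (t \<otimes> s)"
      by (simp add: localization_mult I.Icarr)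
    then show ?thesis using * by (simp add: fraction_mem_ext S_mult I.I_l_closed)
  qed
  have add: "x \<oplus>\<^bsub>localization A S\<^esub> y \<in> ext I" if "y \<in> ext I" "x \<in> ext I" for x y
  proof -
    from that obtain a s b t where "a \<in> I" "s \<in> S" "b \<in> I" "t \<in> S"
      "x = fraction A S a s" "y = fraction A S b t"
      by (auto simp: ext_def)
    moreover from this have "a \<otimes> t \<oplus> b \<otimes> s \<in> I" by (simp add: I.I_r_closed)
    ultimately show ?thesis 
      using I.Icarr by (simp add: fraction_mem_ext S_mult localization_add)
  qed
  have sub: "ext I \<subseteq> carrier (localization A S)" by (rule ext_subset) (rule I.a_subset)
  show ?thesis
  proof (rule idealI[OF L.ring_axioms])
    show "subgroup (ext I) (add_monoid (localization A S))"
    proof (rule L.add.subgroupI)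
      show "ext I \<noteq> {}" using fraction_mem_ext[OF I.zero_closed S_one] by auto
      fix x assume x: "x \<in> ext I"
      then have "(\<ominus>\<^bsub>localization A S\<^esub> \<one>\<^bsub>localization A S\<^esub>) \<otimes>\<^bsub>localization A S\<^esub> x \<in> ext I"
        by (intro mult) auto
      then show "\<ominus>\<^bsub>localization A S\<^esub> x \<in> ext I" using x sub by (simp add: subset_iff L.l_minus)
    qed (use sub add in auto)
    fix a x assume *: "a \<in> ext I" "x \<in> carrier (localization A S)"
    then show "x \<otimes>\<^bsub>localization A S\<^esub> a \<in> ext I" by (rule mult)
    then show "a \<otimes>\<^bsub>localization A S\<^esub> x \<in> ext I" using * sub L.m_comm by auto
  qed
qed

lemma genideal_image_eq_ext:
  assumes "ideal I A"
  shows "Idl\<^bsub>localization A S\<^esub> ((\<lambda>a. fraction A S a \<one>) ` I) = ext I"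
proof
  interpret I: ideal I A by fact
  interpret L: cring "localization A S" by (rule localization_cring)
  show "Idl\<^bsub>localization A S\<^esub> ((\<lambda>a. fraction A S a \<one>) ` I) \<subseteq> ext I"
    using S_one by (intro L.genideal_minimal ext_ideal assms) (auto simp: ext_def)
  have sub: "(\<lambda>a. fraction A S a \<one>) ` I \<subseteq> carrier (localization A S)"
    using S_one by auto
  interpret J: ideal "Idl\<^bsub>localization A S\<^esub> ((\<lambda>a. fraction A S a \<one>) ` I)" "localization A S"
    by (rule L.genideal_ideal[OF sub])
  show "ext I \<subseteq> Idl\<^bsub>localization A S\<^esub> ((\<lambda>a. fraction A S a \<one>) ` I)"
  proof
    fix x assume "x \<in> ext I"
    then obtain a s where *: "a \<in> I" "s \<in> S" "x = fraction A S a s" by (rule ext_cases)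
    then have "x = fraction A S \<one> s \<otimes>\<^bsub>localization A S\<^esub> fraction A S a \<one>"
      using S_one by (simp add: localization_mult I.Icarr)
    moreover have "fraction A S a \<one> \<in> Idl\<^bsub>localization A S\<^esub> ((\<lambda>a. fraction A S a \<one>) ` I)"
      using L.genideal_self[OF sub] * by auto
    ultimately show "x \<in> Idl\<^bsub>localization A S\<^esub> ((\<lambda>a. fraction A S a \<one>) ` I)"
      using * by (simp add: J.I_l_closed)
  qed
qed

lemma ext_ideal_prod:
  assumes "ideal I A" "ideal J A"
  shows "ideal_prod (localization A S) (ext I) (ext J) = ext (ideal_prod A I J)"
proof
  interpret I: ideal I A by fact
  interpret J: ideal J A by fact
  interpret IJ: ideal "ideal_prod A I J" A by (rule ideal_prod_is_ideal[OF assms])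
  interpret E: ideal "ext (ideal_prod A I J)" "localization A S"
    by (rule ext_ideal) (rule ideal_prod_is_ideal[OF assms])
  show "ideal_prod (localization A S) (ext I) (ext J) \<subseteq> ext (ideal_prod A I J)"
  proof
    fix x assume "x \<in> ideal_prod (localization A S) (ext I) (ext J)"
    then show "x \<in> ext (ideal_prod A I J)"
    proof induct
      case (prod x y)
      then obtain a s b t where "a \<in> I" "s \<in> S" "b \<in> J" "t \<in> S"
        "x = fraction A S a s" "y = fraction A S b t"
        by (metis ext_cases)
      then show ?case using ideal_prod.prod[of a I b J A]
        by (simp add: fraction_mem_ext S_mult localization_mult)
    next
      case (sum x y)
      then show ?case by (simp add: E.a_closed)
    qed
  qed
  \<comment> \<open>The whole denominator goes to the first factor of a product. Hence
    \<open>s\<close> stays fixed in the induction, and the two summands of the additive step share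
    it.\<close>
  have "fraction A S a s \<in> ideal_prod (localization A S) (ext I) (ext J)"
    if "a \<in> ideal_prod A I J" "s \<in> S" for a s
    using that
  proof induct
    case (prod a b)
    then have "fraction A S (a \<otimes> b) s = fraction A S a s \<otimes>\<^bsub>localization A S\<^esub> fraction A S b \<one>"
      using S_one by (simp add: localization_mult)
    also have "\<dots> \<in> ideal_prod (localization A S) (ext I) (ext J)"
      using prod S_one by (intro ideal_prod.prod) (simp_all add: fraction_mem_ext)
    finally show ?case .
  next
    case (sum a b)
    then have "fraction A S (a \<oplus> b) s = fraction A S a s \<oplus>\<^bsub>localization A S\<^esub> fraction A S b s"
      using IJ.Icarr by (simp add: localization_add_same)
    then show ?case using ideal_prod.sum[OF sum(2)[OF sum(5)] sum(4)[OF sum(5)]] by simp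
  qed
  then show "ext (ideal_prod A I J) \<subseteq> ideal_prod (localization A S) (ext I) (ext J)"
    by (auto simp: ext_def)
qed

end

section \<open>Powers of ideals and their extensions\<close>

lemma (in cring) ideal_nat_pow:
  assumes "ideal I R"
  shows "ideal (I [^]\<^bsub>ideals_set R\<^esub> (n::nat)) R"
proof -
  interpret M: comm_monoid "ideals_set R" by (rule ideals_set_is_comm_monoid)
  show ?thesis using M.nat_pow_closed[of I n] assms by (simp add: ideals_set_def)
qed

lemma (in cring) ideal_nat_pow_0: "I [^]\<^bsub>ideals_set R\<^esub> (0::nat) = carrier R"
  by (simp add: ideals_set_def)

lemma (in cring) ideal_nat_pow_Suc:
  "I [^]\<^bsub>ideals_set R\<^esub> Suc n = ideal_prod R (I [^]\<^bsub>ideals_set R\<^esub> n) I"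
  by (simp add: ideals_set_def)

lemma (in cring) ideal_nat_pow_add:
  assumes "ideal I R" "a \<in> I [^]\<^bsub>ideals_set R\<^esub> (m::nat)" "b \<in> I [^]\<^bsub>ideals_set R\<^esub> (n::nat)"
  shows "a \<otimes> b \<in> I [^]\<^bsub>ideals_set R\<^esub> (m + n)"
proof -
  interpret M: comm_monoid "ideals_set R" by (rule ideals_set_is_comm_monoid)
  have "I [^]\<^bsub>ideals_set R\<^esub> m \<otimes>\<^bsub>ideals_set R\<^esub> I [^]\<^bsub>ideals_set R\<^esub> n = I [^]\<^bsub>ideals_set R\<^esub> (m + n)"
    using assms(1) by (intro M.nat_pow_mult) (simp add: ideals_set_def)
  moreover have "mult (ideals_set R) = ideal_prod R"
    by (simp add: ideals_set_def)
  ultimately show ?thesis using ideal_prod.prod[OF assms(2,3), of R] by simp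
qed

lemma (in cring) ideal_nat_pow_antimono:
  assumes "ideal I R" "m \<le> n"
  shows "I [^]\<^bsub>ideals_set R\<^esub> (n::nat) \<subseteq> I [^]\<^bsub>ideals_set R\<^esub> m"
  using assms(2)
proof (induct n rule: dec_induct)
  case (step n)
  then show ?case
    using ideal_prod_inter[OF ideal_nat_pow[OF assms(1), of n] assms(1)] ideal_nat_pow_Suc[of I n]
    by auto
qed simp

lemma (in mult_subset) ext_carrier: "ext (carrier A) = carrier (localization A S)"
proof
  show "carrier (localization A S) \<subseteq> ext (carrier A)"
    using fraction_mem_ext by (auto elim: fraction_cases)
qed (simp add: ext_subset)

text \<open>The symbolic powers of \<open>p A_q\<close> are defined by ideal powers taken in
  \<open>A_q\<close>; this brings them back to powers taken in \<open>A\<close>.\<close>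

lemma (in mult_subset) ext_nat_pow:
  assumes "ideal I A"
  shows "ext I [^]\<^bsub>ideals_set (localization A S)\<^esub> (n::nat) = ext (I [^]\<^bsub>ideals_set A\<^esub> n)"
proof -
  interpret L: cring "localization A S" by (rule localization_cring)
  show ?thesis
  proof (induct n)
    case 0
    show ?case by (simp only: L.ideal_nat_pow_0 ideal_nat_pow_0 ext_carrier)
  next
    case (Suc n)
    then show ?case
      by (simp only: L.ideal_nat_pow_Suc ideal_nat_pow_Suc ext_ideal_prod[OF ideal_nat_pow[OF assms] assms])
  qed
qed

lemma primeideal_mult_subset:
  assumes "primeideal p A"
  shows "mult_subset A (carrier A - p)"
proof -
  interpret primeideal p A by fact
  show ?thesis
  proof
    show "\<one>\<^bsub>A\<^esub> \<in> carrier A - p" using one_imp_carrier I_notcarr by auto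
  qed (use I_prime in auto)
qed

section \<open>Symbolic powers\<close>

lemma local_at_cring: "primeideal q A \<Longrightarrow> cring (local_at A q)"
  unfolding local_at_def by (intro mult_subset.localization_cring primeideal_mult_subset)

lemma local_ext_eq:
  assumes "primeideal q A" "ideal I A"
  shows "local_ext A q I = mult_subset.ext A (carrier A - q) I"
proof -
  interpret mult_subset A "carrier A - q" by (rule primeideal_mult_subset) fact
  show ?thesis using genideal_image_eq_ext[OF assms(2)]
    by (simp add: local_ext_def to_local_def[abs_def] local_at_def)
qed

lemma fraction_mem_local_ext_iff:
  assumes "primeideal q A" "ideal I A" "a \<in> carrier A" "s \<in> carrier A - q"
  shows "fraction A (carrier A - q) a s \<in> local_ext A q I \<longleftrightarrow>
    (\<exists>u\<in>carrier A - q. u \<otimes>\<^bsub>A\<^esub> a \<in> I)"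
proof -
  interpret mult_subset A "carrier A - q" by (rule primeideal_mult_subset) fact
  show ?thesis using assms by (simp add: local_ext_eq fraction_mem_ext_iff)
qed

text \<open>The multiplier \<open>u\<close> of the general criterion lies outside \<open>q\<close>,
  hence outside \<open>p\<close>, and primality cancels it.\<close>

lemma fraction_mem_local_ext_prime_iff:
  assumes "primeideal q A" "primeideal p A" "p \<subseteq> q" "a \<in> carrier A" "s \<in> carrier A - q"
  shows "fraction A (carrier A - q) a s \<in> local_ext A q p \<longleftrightarrow> a \<in> p"
proof -
  interpret mult_subset A "carrier A - q" by (rule primeideal_mult_subset) fact
  interpret p: primeideal p A by fact
  show ?thesis
    using assms S_one p.I_prime p.I_l_closed
    by (auto simp: fraction_mem_local_ext_iff[OF assms(1) p.is_ideal] intro!: bexI[of _ "\<one>\<^bsub>A\<^esub>"])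
qed

lemma primeideal_local_ext:
  fixes A (structure)
  assumes "primeideal q A" "primeideal p A" "p \<subseteq> q"
  shows "primeideal (local_ext A q p) (local_at A q)"
proof -
  interpret mult_subset A "carrier A - q" by (rule primeideal_mult_subset) fact
  interpret p: primeideal p A by fact
  show ?thesis
  proof (rule primeidealI)
    show "ideal (local_ext A q p) (local_at A q)"
      unfolding local_ext_eq[OF assms(1) p.is_ideal] unfolding local_at_def
      by (rule ext_ideal) (rule p.is_ideal)
    show "cring (local_at A q)" by (rule local_at_cring) fact
    have "fraction A (carrier A - q) \<one> \<one> \<notin> local_ext A q p"
      using fraction_mem_local_ext_prime_iff[OF assms one_closed S_one] p.one_imp_carrier p.I_notcarr
      by auto
    then show "carrier (local_at A q) \<noteq> local_ext A q p"
      using fraction_closed[OF one_closed S_one] by (auto simp: local_at_def)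
    fix x y assume xy: "x \<in> carrier (local_at A q)" "y \<in> carrier (local_at A q)"
      "x \<otimes>\<^bsub>local_at A q\<^esub> y \<in> local_ext A q p"
    obtain a s b t where *: "a \<in> carrier A" "s \<in> carrier A - q" "x = fraction A (carrier A - q) a s"
      "b \<in> carrier A" "t \<in> carrier A - q" "y = fraction A (carrier A - q) b t"
      using xy(1,2) unfolding local_at_def by (metis fraction_cases)
    have "fraction A (carrier A - q) (a \<otimes> b) (s \<otimes> t) \<in> local_ext A q p"
      using xy(3) * by (simp add: local_at_def localization_mult)
    then have "a \<otimes> b \<in> p"
      using fraction_mem_local_ext_prime_iff[OF assms m_closed[OF *(1,4)] S_mult[OF *(2,5)]] by simp
    then show "x \<in> local_ext A q p \<or> y \<in> local_ext A q p"
      using * p.I_prime fraction_mem_local_ext_prime_iff[OF assms] by auto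
  qed
qed

text \<open>This removes the localization at \<open>p\<close> from the definition. It also merges
  its two cases: for \<open>n \<le> 0\<close> the exponent \<open>nat n\<close> is 0, the power is
  the whole ring, and \<open>s = \<one>\<close> serves.\<close>

lemma mem_symbolic_power_iff:
  assumes "primeideal p A"
  shows "a \<in> symbolic_power A p n \<longleftrightarrow>
    a \<in> carrier A \<and> (\<exists>s\<in>carrier A - p. s \<otimes>\<^bsub>A\<^esub> a \<in> p [^]\<^bsub>ideals_set A\<^esub> nat n)"
proof -
  interpret mult_subset A "carrier A - p" by (rule primeideal_mult_subset) fact
  interpret p: primeideal p A by fact
  show ?thesis
  proof (cases "n \<le> 0")
    case True
    then have "nat n = 0" by simp
    then have "p [^]\<^bsub>ideals_set A\<^esub> nat n = carrier A" by (simp only: ideal_nat_pow_0)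
    then show ?thesis using True S_one by (auto simp: symbolic_power_def)
  next
    case False
    then show ?thesis
      using fraction_mem_local_ext_iff[OF assms ideal_nat_pow[OF p.is_ideal, of "nat n"] _ S_one]
      by (auto simp: symbolic_power_def to_local_def)
  qed
qed

text \<open>The properties of symbolic powers on which Rees and graded rings rest. They are isolated
  because three filtrations share them: the symbolic powers of \<open>p\<close> in \<open>A\<close>,
  those of \<open>p A_q\<close> in \<open>A_q\<close>, and the one that yields
  \<open>A[1/t]\<close>.\<close>

locale int_filtration = cring B for B (structure) +
  fixes F :: "int \<Rightarrow> 'a set"
  assumes F_ideal: "ideal (F n) B"
    and F_nonpos: "n \<le> 0 \<Longrightarrow> F n = carrier B"
    and F_antimono: "m \<le> n \<Longrightarrow> F n \<subseteq> F m"
    and F_mult: "\<lbrakk>a \<in> F m; b \<in> F n\<rbrakk> \<Longrightarrow> a \<otimes> b \<in> F (m + n)"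

lemma int_filtration_symbolic_power:
  fixes A (structure)
  assumes "primeideal p A"
  shows "int_filtration A (symbolic_power A p)"
proof -
  interpret mult_subset A "carrier A - p" by (rule primeideal_mult_subset) fact
  interpret p: primeideal p A by fact
  let ?P = "\<lambda>n. p [^]\<^bsub>ideals_set A\<^esub> nat n"
  have ideal: "ideal (?P n) A" for n by (rule ideal_nat_pow) (rule p.is_ideal)
  note iff = mem_symbolic_power_iff[OF assms]
  have mult: "x \<otimes> a \<in> symbolic_power A p n" if "a \<in> symbolic_power A p n" "x \<in> carrier A" for x a n
  proof -
    from that obtain s where s: "a \<in> carrier A" "s \<in> carrier A - p" "s \<otimes> a \<in> ?P n"
      unfolding iff by blast
    then have "x \<otimes> (s \<otimes> a) \<in> ?P n" using ideal.I_l_closed[OF ideal] that by blast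
    moreover have "x \<otimes> (s \<otimes> a) = s \<otimes> (x \<otimes> a)" using s that by (simp add: m_ac)
    ultimately show ?thesis using s that unfolding iff by auto
  qed
  show ?thesis
  proof (intro int_filtration.intro int_filtration_axioms.intro)
    show "cring A" by (rule is_cring)
    show "symbolic_power A p n = carrier A" if "n \<le> 0" for n
      using that by (simp add: symbolic_power_def)
    show "symbolic_power A p n \<subseteq> symbolic_power A p m" if "m \<le> n" for m n
    proof
      fix a assume "a \<in> symbolic_power A p n"
      then show "a \<in> symbolic_power A p m"
        using ideal_nat_pow_antimono[OF p.is_ideal nat_mono[OF that]] unfolding iff by blast
    qed
    show "ideal (symbolic_power A p n) A" for n
    proof (rule idealI[OF ring_axioms])
      show "subgroup (symbolic_power A p n) (add_monoid A)"
      proof (rule add.subgroupI)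
        show "symbolic_power A p n \<subseteq> carrier A" using iff by blast
        have "\<zero> \<in> symbolic_power A p n"
          unfolding iff using S_one additive_subgroup.zero_closed[OF ideal.axioms(1)[OF ideal]]
          by (auto intro!: bexI[of _ \<one>])
        then show "symbolic_power A p n \<noteq> {}" by auto
        show "\<ominus> a \<in> symbolic_power A p n" if "a \<in> symbolic_power A p n" for a
        proof -
          have "(\<ominus> \<one>) \<otimes> a \<in> symbolic_power A p n" using that by (intro mult) simp_all
          then show ?thesis using that unfolding iff by (simp add: l_minus)
        qed
        fix a b assume "a \<in> symbolic_power A p n" "b \<in> symbolic_power A p n"
        then obtain s t where *: "a \<in> carrier A" "s \<in> carrier A - p" "s \<otimes> a \<in> ?P n"
          "b \<in> carrier A" "t \<in> carrier A - p" "t \<otimes> b \<in> ?P n"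
          unfolding iff by auto
        have "t \<otimes> (s \<otimes> a) \<oplus> s \<otimes> (t \<otimes> b) \<in> ?P n"
          using * ideal.I_l_closed[OF ideal] additive_subgroup.a_closed[OF ideal.axioms(1)[OF ideal]]
          by blast
        also have "t \<otimes> (s \<otimes> a) \<oplus> s \<otimes> (t \<otimes> b) = (s \<otimes> t) \<otimes> (a \<oplus> b)"
          using * by (simp add: r_distr m_ac)
        finally show "a \<oplus> b \<in> symbolic_power A p n"
          using * S_mult unfolding iff by blast
      qed
      fix a x assume *: "a \<in> symbolic_power A p n" "x \<in> carrier A"
      then show "x \<otimes> a \<in> symbolic_power A p n" by (rule mult)
      then show "a \<otimes> x \<in> symbolic_power A p n" using * unfolding iff by (simp add: m_comm)
    qed
    fix a b and m n assume "a \<in> symbolic_power A p m" "b \<in> symbolic_power A p n"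
    then obtain s t where *: "a \<in> carrier A" "s \<in> carrier A - p" "s \<otimes> a \<in> ?P m"
      "b \<in> carrier A" "t \<in> carrier A - p" "t \<otimes> b \<in> ?P n"
      unfolding iff by auto
    \<comment> \<open>Only an inequality, as truncation at 0 loses something for degrees of opposite
      sign. The product then lies in a higher power than required, and antitonicity of powers closes
      the gap.\<close>
    have "nat (m + n) \<le> nat m + nat n" by linarith
    moreover have "(s \<otimes> a) \<otimes> (t \<otimes> b) \<in> p [^]\<^bsub>ideals_set A\<^esub> (nat m + nat n)"
      using * by (intro ideal_nat_pow_add p.is_ideal)
    ultimately have "(s \<otimes> a) \<otimes> (t \<otimes> b) \<in> ?P (m + n)"
      using ideal_nat_pow_antimono[OF p.is_ideal, of "nat (m + n)" "nat m + nat n"] by blast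
    also have "(s \<otimes> a) \<otimes> (t \<otimes> b) = (s \<otimes> t) \<otimes> (a \<otimes> b)"
      using * by (simp add: m_ac)
    finally show "a \<otimes> b \<in> symbolic_power A p (m + n)"
      using * S_mult unfolding iff by blast
  qed
qed

text \<open>Localizing \<open>A_q\<close> further at \<open>p A_q\<close> only gives
  \<open>A_p\<close>. Instead of building this isomorphism, the proof compares multipliers: one
  outside \<open>p A_q\<close> is a fraction \<open>b/t\<close> with \<open>b\<close> outside
  \<open>p\<close>, and the extra multiplier \<open>u\<close> that comes from extending to
  \<open>A_q\<close> is merged with \<open>b\<close>.\<close>

lemma fraction_mem_symbolic_power_iff:
  fixes A (structure)
  assumes "primeideal q A" "primeideal p A" "p \<subseteq> q" "a \<in> carrier A" "s \<in> carrier A - q"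
  shows "fraction A (carrier A - q) a s \<in> symbolic_power (local_at A q) (local_ext A q p) n \<longleftrightarrow>
    a \<in> symbolic_power A p n"
proof -
  let ?fr = "fraction A (carrier A - q)"
  let ?P = "p [^]\<^bsub>ideals_set A\<^esub> nat n"
  interpret mult_subset A "carrier A - q" by (rule primeideal_mult_subset) fact
  interpret p: primeideal p A by fact
  interpret L: cring "local_at A q" by (rule local_at_cring) fact
  have ideal: "ideal ?P A" by (rule ideal_nat_pow) (rule p.is_ideal)
  have pow: "local_ext A q p [^]\<^bsub>ideals_set (local_at A q)\<^esub> nat n = local_ext A q ?P"
    unfolding local_ext_eq[OF assms(1) p.is_ideal] local_ext_eq[OF assms(1) ideal]
    unfolding local_at_def by (rule ext_nat_pow) (rule p.is_ideal)
  have mem: "?fr (b \<otimes> a) (t \<otimes> s) \<in> local_ext A q ?P \<longleftrightarrow> (\<exists>u\<in>carrier A - q. u \<otimes> (b \<otimes> a) \<in> ?P)"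
    if "b \<in> carrier A" "t \<in> carrier A - q" for b t
    using that assms by (intro fraction_mem_local_ext_iff ideal m_closed S_mult) auto
  have "?fr a s \<in> symbolic_power (local_at A q) (local_ext A q p) n \<longleftrightarrow>
    (\<exists>y\<in>carrier (local_at A q) - local_ext A q p. y \<otimes>\<^bsub>local_at A q\<^esub> ?fr a s \<in> local_ext A q ?P)"
    unfolding mem_symbolic_power_iff[OF primeideal_local_ext[OF assms(1-3)]] pow
    using assms(4,5) by (simp add: local_at_def)
  also have "\<dots> \<longleftrightarrow> (\<exists>b\<in>carrier A - p. \<exists>t\<in>carrier A - q. ?fr (b \<otimes> a) (t \<otimes> s) \<in> local_ext A q ?P)"
  proof
    assume "\<exists>y\<in>carrier (local_at A q) - local_ext A q p. y \<otimes>\<^bsub>local_at A q\<^esub> ?fr a s \<in> local_ext A q ?P"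
    then obtain y where y: "y \<in> carrier (local_at A q)" "y \<notin> local_ext A q p"
      "y \<otimes>\<^bsub>local_at A q\<^esub> ?fr a s \<in> local_ext A q ?P" by auto
    obtain b t where "b \<in> carrier A" "t \<in> carrier A - q" "y = ?fr b t"
      using y(1) unfolding local_at_def by (rule fraction_cases)
    then show "\<exists>b\<in>carrier A - p. \<exists>t\<in>carrier A - q. ?fr (b \<otimes> a) (t \<otimes> s) \<in> local_ext A q ?P"
      using y(2,3) assms fraction_mem_local_ext_prime_iff[OF assms(1-3)]
      by (auto simp: local_at_def localization_mult)
  next
    assume "\<exists>b\<in>carrier A - p. \<exists>t\<in>carrier A - q. ?fr (b \<otimes> a) (t \<otimes> s) \<in> local_ext A q ?P"
    then obtain b t where bt: "b \<in> carrier A - p" "t \<in> carrier A - q"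
      "?fr (b \<otimes> a) (t \<otimes> s) \<in> local_ext A q ?P" by auto
    then show "\<exists>y\<in>carrier (local_at A q) - local_ext A q p. y \<otimes>\<^bsub>local_at A q\<^esub> ?fr a s \<in> local_ext A q ?P"
      using assms fraction_mem_local_ext_prime_iff[OF assms(1-3), of b t]
      by (intro bexI[of _ "?fr b t"]) (simp_all add: local_at_def localization_mult)
  qed
  also have "\<dots> \<longleftrightarrow> (\<exists>b\<in>carrier A - p. b \<otimes> a \<in> ?P)"
  proof
    assume "\<exists>b\<in>carrier A - p. \<exists>t\<in>carrier A - q. ?fr (b \<otimes> a) (t \<otimes> s) \<in> local_ext A q ?P"
    then obtain b u where "b \<in> carrier A - p" "u \<in> carrier A - q" "u \<otimes> (b \<otimes> a) \<in> ?P"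
      using mem by blast
    \<comment> \<open>A factor outside \<open>q\<close> is outside \<open>p\<close>, so primality of
      \<open>p\<close> makes the product an admissible multiplier for the symbolic power.\<close>
    moreover from this have "u \<otimes> b \<in> carrier A - p" using p.I_prime assms(3) by blast
    ultimately show "\<exists>b\<in>carrier A - p. b \<otimes> a \<in> ?P"
      using assms(4) by (intro bexI[of _ "u \<otimes> b"]) (simp_all add: m_assoc)
  next
    assume "\<exists>b\<in>carrier A - p. b \<otimes> a \<in> ?P"
    then obtain b where b: "b \<in> carrier A - p" "b \<otimes> a \<in> ?P" by auto
    then have "\<one> \<otimes> (b \<otimes> a) \<in> ?P" using assms(4) by simp
    then show "\<exists>b\<in>carrier A - p. \<exists>t\<in>carrier A - q. ?fr (b \<otimes> a) (t \<otimes> s) \<in> local_ext A q ?P"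
      using b mem[of b \<one>] S_one by blast
  qed
  finally show ?thesis using assms(4) by (simp add: mem_symbolic_power_iff[OF assms(2)])
qed

section \<open>Laurent polynomials\<close>

lemma (in ideal) finsum_mem:
  assumes "\<And>i. i \<in> K \<Longrightarrow> f i \<in> I"
  shows "(\<Oplus>i\<in>K. f i) \<in> I"
  using assms
proof (induct K rule: infinite_finite_induct)
  case (insert i K)
  then have "(\<Oplus>i\<in>insert i K. f i) = f i \<oplus> (\<Oplus>i\<in>K. f i)"
    by (intro finsum_insert) (auto simp: Icarr)
  then show ?case using insert by simp
qed simp_all

context cring
begin

lemma mem_Laurent_iff:
  "f \<in> carrier (Laurent R) \<longleftrightarrow> (\<forall>n. f n \<in> carrier R) \<and> finite {n. f n \<noteq> \<zero>}"
  by (auto simp: Laurent_def)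

lemma Laurent_coeff [simp]: "f \<in> carrier (Laurent R) \<Longrightarrow> f n \<in> carrier R"
  by (simp add: mem_Laurent_iff)

lemma Laurent_finite: "f \<in> carrier (Laurent R) \<Longrightarrow> finite {n. f n \<noteq> \<zero>}"
  by (simp add: mem_Laurent_iff)

lemma Laurent_add: "f \<oplus>\<^bsub>Laurent R\<^esub> g = (\<lambda>n. f n \<oplus> g n)"
  by (simp add: Laurent_def)

lemma Laurent_zero: "\<zero>\<^bsub>Laurent R\<^esub> = (\<lambda>n. \<zero>)"
  by (simp add: Laurent_def)

lemma Laurent_one: "\<one>\<^bsub>Laurent R\<^esub> = lterm R \<one> 0"
  by (simp add: Laurent_def lterm_def)

text \<open>The definition sums over the exact support of \<open>f\<close>, which is awkward under
  sums, shifts and reflections. A free finite \<open>K\<close> above the support lets different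
  products be written over one index set.\<close>

lemma Laurent_mult:
  assumes "finite K" "{i. f i \<noteq> \<zero>} \<subseteq> K" "f \<in> carrier (Laurent R)" "g \<in> carrier (Laurent R)"
  shows "(f \<otimes>\<^bsub>Laurent R\<^esub> g) n = (\<Oplus>i\<in>K. f i \<otimes> g (n - i))"
proof -
  have "(f \<otimes>\<^bsub>Laurent R\<^esub> g) n = (\<Oplus>i\<in>{i. f i \<noteq> \<zero>}. f i \<otimes> g (n - i))"
    by (simp add: Laurent_def)
  also have "\<dots> = (\<Oplus>i\<in>K. f i \<otimes> g (n - i))"
    using assms by (intro add.finprod_mono_neutral_cong_left) auto
  finally show ?thesis .
qed

lemma lterm_closed [simp]: "a \<in> carrier R \<Longrightarrow> lterm R a n \<in> carrier (Laurent R)"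
  by (auto simp: mem_Laurent_iff lterm_def intro: finite_subset[of _ "{n}"])

lemma lterm_mult:
  assumes "a \<in> carrier R" "g \<in> carrier (Laurent R)"
  shows "lterm R a m \<otimes>\<^bsub>Laurent R\<^esub> g = (\<lambda>n. a \<otimes> g (n - m))"
proof
  fix n
  show "(lterm R a m \<otimes>\<^bsub>Laurent R\<^esub> g) n = a \<otimes> g (n - m)"
    using assms lterm_closed[of a m]
    by (subst Laurent_mult[of "{m}"]) (auto simp: lterm_def[abs_def] simp del: lterm_closed)
qed

lemma lterm_mult_lterm:
  "\<lbrakk>a \<in> carrier R; b \<in> carrier R\<rbrakk> \<Longrightarrow>
    lterm R a m \<otimes>\<^bsub>Laurent R\<^esub> lterm R b n = lterm R (a \<otimes> b) (m + n)"
  using lterm_closed[of b n] by (auto simp: lterm_mult) (auto simp: lterm_def fun_eq_iff)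

lemma lterm_add:
  "\<lbrakk>a \<in> carrier R; b \<in> carrier R\<rbrakk> \<Longrightarrow>
    lterm R a m \<oplus>\<^bsub>Laurent R\<^esub> lterm R b m = lterm R (a \<oplus> b) m"
  by (auto simp: lterm_def fun_eq_iff Laurent_add)

text \<open>The condition \<open>g n = \<zero>\<close> keeps the new term apart from
  \<open>g\<close>. A condition on every coefficient of the sum therefore splits into one on
  \<open>a\<close> and one on \<open>g\<close>, which is how membership in a Rees ring is passed
  down the induction.\<close>

lemma Laurent_induct [consumes 1, case_names zero add]:
  assumes "f \<in> carrier (Laurent R)"
    and "P \<zero>\<^bsub>Laurent R\<^esub>"
    and "\<And>a n g. \<lbrakk>a \<in> carrier R; g \<in> carrier (Laurent R); a \<noteq> \<zero>; g n = \<zero>; P g; 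
      lterm R a n \<oplus>\<^bsub>Laurent R\<^esub> g \<in> carrier (Laurent R)\<rbrakk> \<Longrightarrow> P (lterm R a n \<oplus>\<^bsub>Laurent R\<^esub> g)"
  shows "P f"
proof -
  have "P f" if "finite K" "K = {n. f n \<noteq> \<zero>}" "f \<in> carrier (Laurent R)" for K f
    using that
  proof (induct K arbitrary: f)
    case empty
    then have "f = \<zero>\<^bsub>Laurent R\<^esub>" by (auto simp: Laurent_zero)
    then show ?case using assms(2) by simp
  next
    case (insert n K)
    let ?g = "f(n := \<zero>)"
    have K: "K = {m. ?g m \<noteq> \<zero>}" using insert(2,4) by auto
    then have g: "?g \<in> carrier (Laurent R)"
      using insert(1,5) by (auto simp: mem_Laurent_iff)
    have f: "f = lterm R (f n) n \<oplus>\<^bsub>Laurent R\<^esub> ?g"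
      using insert(5) by (auto simp: lterm_def Laurent_add fun_eq_iff)
    have "f n \<noteq> \<zero>" using insert(4) by auto
    then have "P (lterm R (f n) n \<oplus>\<^bsub>Laurent R\<^esub> ?g)"
    proof (intro assms(3))
      show "P ?g" by (rule insert(3)[OF K g])
    qed (use insert(5) g f in auto)
    then show ?case using f by simp
  qed
  then show ?thesis using assms(1) Laurent_finite by blast
qed

lemma Laurent_add_closed:
  assumes "f \<in> carrier (Laurent R)" "g \<in> carrier (Laurent R)"
  shows "f \<oplus>\<^bsub>Laurent R\<^esub> g \<in> carrier (Laurent R)"
proof -
  have "{n. f n \<oplus> g n \<noteq> \<zero>} \<subseteq> {n. f n \<noteq> \<zero>} \<union> {n. g n \<noteq> \<zero>}" by auto
  then have "finite {n. f n \<oplus> g n \<noteq> \<zero>}"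
    using Laurent_finite[OF assms(1)] Laurent_finite[OF assms(2)] by (meson finite_UnI finite_subset)
  then show ?thesis using assms by (simp add: Laurent_add mem_Laurent_iff)
qed

lemma Laurent_abelian_group: "abelian_group (Laurent R)"
proof (rule abelian_groupI)
  fix f assume f: "f \<in> carrier (Laurent R)"
  have "{n. \<ominus> f n \<noteq> \<zero>} \<subseteq> {n. f n \<noteq> \<zero>}" using f by auto
  then have "finite {n. \<ominus> f n \<noteq> \<zero>}" using Laurent_finite[OF f] by (rule finite_subset)
  then have "(\<lambda>n. \<ominus> f n) \<in> carrier (Laurent R)" using f by (simp add: mem_Laurent_iff)
  moreover have "(\<lambda>n. \<ominus> f n) \<oplus>\<^bsub>Laurent R\<^esub> f = \<zero>\<^bsub>Laurent R\<^esub>"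
    using f by (simp add: Laurent_add Laurent_zero l_neg)
  ultimately show "\<exists>g\<in>carrier (Laurent R). g \<oplus>\<^bsub>Laurent R\<^esub> f = \<zero>\<^bsub>Laurent R\<^esub>" by blast
qed (auto simp: Laurent_add_closed, auto simp: Laurent_add Laurent_zero mem_Laurent_iff a_ac)

lemma Laurent_mult_comm:
  assumes "f \<in> carrier (Laurent R)" "g \<in> carrier (Laurent R)"
  shows "f \<otimes>\<^bsub>Laurent R\<^esub> g = g \<otimes>\<^bsub>Laurent R\<^esub> f"
proof
  fix n
  \<comment> \<open>Chosen so that \<open>K\<close> contains the support of \<open>f\<close> and its
    reflection contains the support of \<open>g\<close>; the two products are then sums over
    \<open>K\<close> and over its reflection.\<close>
  define K where "K = {i. f i \<noteq> \<zero>} \<union> (\<lambda>j. n - j) ` {j. g j \<noteq> \<zero>}"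
  have K: "finite K" "{i. f i \<noteq> \<zero>} \<subseteq> K"
    using Laurent_finite[OF assms(1)] Laurent_finite[OF assms(2)] by (auto simp: K_def)
  have "j \<in> (\<lambda>j. n - j) ` K" if "g j \<noteq> \<zero>" for j
    using that by (intro image_eqI[of _ _ "n - j"]) (auto simp: K_def)
  then have K': "{i. g i \<noteq> \<zero>} \<subseteq> (\<lambda>j. n - j) ` K" by blast
  have "(g \<otimes>\<^bsub>Laurent R\<^esub> f) n = (\<Oplus>i\<in>(\<lambda>j. n - j) ` K. g i \<otimes> f (n - i))"
    using K K' assms by (intro Laurent_mult) auto
  also have "\<dots> = (\<Oplus>j\<in>K. g (n - j) \<otimes> f (n - (n - j)))"
    using assms by (intro add.finprod_reindex) (auto simp: inj_on_def)
  also have "\<dots> = (\<Oplus>j\<in>K. f j \<otimes> g (n - j))"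
    using assms by (intro add.finprod_cong') (auto simp: m_comm)
  also have "\<dots> = (f \<otimes>\<^bsub>Laurent R\<^esub> g) n"
    using K assms by (intro Laurent_mult[symmetric]) auto
  finally show "(f \<otimes>\<^bsub>Laurent R\<^esub> g) n = (g \<otimes>\<^bsub>Laurent R\<^esub> f) n" by simp
qed

lemma Laurent_l_distr:
  assumes "f \<in> carrier (Laurent R)" "g \<in> carrier (Laurent R)" "h \<in> carrier (Laurent R)"
  shows "(f \<oplus>\<^bsub>Laurent R\<^esub> g) \<otimes>\<^bsub>Laurent R\<^esub> h = f \<otimes>\<^bsub>Laurent R\<^esub> h \<oplus>\<^bsub>Laurent R\<^esub> g \<otimes>\<^bsub>Laurent R\<^esub> h"
proof
  fix n
  define K where "K = {i. f i \<noteq> \<zero>} \<union> {i. g i \<noteq> \<zero>}"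
  have K: "finite K" "{i. f i \<noteq> \<zero>} \<subseteq> K" "{i. g i \<noteq> \<zero>} \<subseteq> K"
    using Laurent_finite[OF assms(1)] Laurent_finite[OF assms(2)] by (auto simp: K_def)
  have K': "{i. (f \<oplus>\<^bsub>Laurent R\<^esub> g) i \<noteq> \<zero>} \<subseteq> K" by (auto simp: K_def Laurent_add)
  have "((f \<oplus>\<^bsub>Laurent R\<^esub> g) \<otimes>\<^bsub>Laurent R\<^esub> h) n = (\<Oplus>i\<in>K. (f \<oplus>\<^bsub>Laurent R\<^esub> g) i \<otimes> h (n - i))"
    using K K' assms by (intro Laurent_mult Laurent_add_closed) auto
  also have "\<dots> = (\<Oplus>i\<in>K. f i \<otimes> h (n - i) \<oplus> g i \<otimes> h (n - i))"
    using assms by (intro add.finprod_cong') (auto simp: Laurent_add l_distr)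
  also have "\<dots> = (\<Oplus>i\<in>K. f i \<otimes> h (n - i)) \<oplus> (\<Oplus>i\<in>K. g i \<otimes> h (n - i))"
    using assms by (intro add.finprod_multf) auto
  also have "\<dots> = (f \<otimes>\<^bsub>Laurent R\<^esub> h \<oplus>\<^bsub>Laurent R\<^esub> g \<otimes>\<^bsub>Laurent R\<^esub> h) n"
    using K assms Laurent_mult[of K f h n] Laurent_mult[of K g h n] by (simp add: Laurent_add)
  finally show "((f \<oplus>\<^bsub>Laurent R\<^esub> g) \<otimes>\<^bsub>Laurent R\<^esub> h) n =
    (f \<otimes>\<^bsub>Laurent R\<^esub> h \<oplus>\<^bsub>Laurent R\<^esub> g \<otimes>\<^bsub>Laurent R\<^esub> h) n" .
qed

lemma zero_mult_Laurent: "\<zero>\<^bsub>Laurent R\<^esub> \<otimes>\<^bsub>Laurent R\<^esub> g = \<zero>\<^bsub>Laurent R\<^esub>"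
  by (simp add: Laurent_def)

lemma lterm_mult_closed:
  assumes "a \<in> carrier R" "g \<in> carrier (Laurent R)"
  shows "lterm R a m \<otimes>\<^bsub>Laurent R\<^esub> g \<in> carrier (Laurent R)"
proof -
  have "{n. a \<otimes> g (n - m) \<noteq> \<zero>} \<subseteq> (\<lambda>n. n + m) ` {n. g n \<noteq> \<zero>}"
  proof
    fix n assume "n \<in> {n. a \<otimes> g (n - m) \<noteq> \<zero>}"
    then show "n \<in> (\<lambda>n. n + m) ` {n. g n \<noteq> \<zero>}"
      using assms by (intro image_eqI[of _ _ "n - m"]) auto
  qed
  then have "finite {n. a \<otimes> g (n - m) \<noteq> \<zero>}"
    using Laurent_finite[OF assms(2)] by (meson finite_imageI finite_subset)
  then show ?thesis using assms by (simp add: lterm_mult mem_Laurent_iff)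
qed

lemma Laurent_mult_closed:
  assumes "f \<in> carrier (Laurent R)" "g \<in> carrier (Laurent R)"
  shows "f \<otimes>\<^bsub>Laurent R\<^esub> g \<in> carrier (Laurent R)"
  using assms(1)
proof (induct rule: Laurent_induct)
  case zero
  then show ?case using abelian_groupE(2)[OF Laurent_abelian_group] by (simp add: zero_mult_Laurent)
next
  case (add a n f)
  then show ?case using assms(2) by (simp add: Laurent_l_distr Laurent_add_closed lterm_mult_closed)
qed

text \<open>Induction on the first factor leaves only a term of degree \<open>m\<close>.
  Multiplication by it shifts and scales, so a reindexing of one sum replaces the exchange of a
  double sum.\<close>

lemma Laurent_mult_assoc:
  assumes "f \<in> carrier (Laurent R)" "g \<in> carrier (Laurent R)" "h \<in> carrier (Laurent R)"
  shows "f \<otimes>\<^bsub>Laurent R\<^esub> g \<otimes>\<^bsub>Laurent R\<^esub> h = f \<otimes>\<^bsub>Laurent R\<^esub> (g \<otimes>\<^bsub>Laurent R\<^esub> h)"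
  using assms(1)
proof (induct rule: Laurent_induct)
  case zero
  then show ?case by (simp add: zero_mult_Laurent)
next
  case (add a m f)
  let ?t = "lterm R a m"
  have "?t \<otimes>\<^bsub>Laurent R\<^esub> g \<otimes>\<^bsub>Laurent R\<^esub> h = ?t \<otimes>\<^bsub>Laurent R\<^esub> (g \<otimes>\<^bsub>Laurent R\<^esub> h)"
  proof
    fix n
    define K where "K = {i. g i \<noteq> \<zero>}"
    have K: "finite K" "{i. g i \<noteq> \<zero>} \<subseteq> K"
      using Laurent_finite[OF assms(2)] by (auto simp: K_def)
    have "j \<in> (\<lambda>j. j + m) ` K" if "(?t \<otimes>\<^bsub>Laurent R\<^esub> g) j \<noteq> \<zero>" for j
    proof (rule image_eqI)
      show "j - m \<in> K" using that add(1) assms(2) by (auto simp: K_def lterm_mult)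
    qed simp
    then have K': "{i. (?t \<otimes>\<^bsub>Laurent R\<^esub> g) i \<noteq> \<zero>} \<subseteq> (\<lambda>j. j + m) ` K" by blast
    have "(?t \<otimes>\<^bsub>Laurent R\<^esub> g \<otimes>\<^bsub>Laurent R\<^esub> h) n =
        (\<Oplus>i\<in>(\<lambda>j. j + m) ` K. (?t \<otimes>\<^bsub>Laurent R\<^esub> g) i \<otimes> h (n - i))"
      using K K' assms add(1) by (intro Laurent_mult lterm_mult_closed) auto
    also have "\<dots> = (\<Oplus>j\<in>K. (?t \<otimes>\<^bsub>Laurent R\<^esub> g) (j + m) \<otimes> h (n - (j + m)))"
      using assms add(1) by (intro add.finprod_reindex) (auto simp: inj_on_def lterm_mult)
    also have "\<dots> = (\<Oplus>j\<in>K. a \<otimes> (g j \<otimes> h (n - m - j)))"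
      using assms add(1)
      by (intro add.finprod_cong') (auto simp: lterm_mult m_assoc algebra_simps)
    also have "\<dots> = a \<otimes> (\<Oplus>j\<in>K. g j \<otimes> h (n - m - j))"
      using K assms add(1) by (intro finsum_rdistr[symmetric]) auto
    also have "\<dots> = (?t \<otimes>\<^bsub>Laurent R\<^esub> (g \<otimes>\<^bsub>Laurent R\<^esub> h)) n"
      using K assms add(1) by (simp add: lterm_mult Laurent_mult_closed Laurent_mult)
    finally show "(?t \<otimes>\<^bsub>Laurent R\<^esub> g \<otimes>\<^bsub>Laurent R\<^esub> h) n = (?t \<otimes>\<^bsub>Laurent R\<^esub> (g \<otimes>\<^bsub>Laurent R\<^esub> h)) n" .
  qed
  then show ?case using add assms(2,3)
    by (simp add: Laurent_l_distr lterm_mult_closed Laurent_mult_closed)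
qed

lemma Laurent_cring: "cring (Laurent R)"
proof (rule cringI[OF Laurent_abelian_group])
  show "Group.comm_monoid (Laurent R)"
  proof (rule comm_monoidI)
    fix f assume "f \<in> carrier (Laurent R)"
    then show "\<one>\<^bsub>Laurent R\<^esub> \<otimes>\<^bsub>Laurent R\<^esub> f = f" by (simp add: Laurent_one lterm_mult)
  qed (simp_all add: Laurent_one Laurent_mult_closed Laurent_mult_assoc, rule Laurent_mult_comm)
qed (rule Laurent_l_distr)

end

section \<open>Rees rings and associated graded rings\<close>

text \<open>The direct sum of the pieces of degree \<open>n\<close> with coefficients in
  \<open>F n\<close>. Membership is a coefficientwise test, which a ring given by generators does
  not offer; \<open>rees_eq_adjoin\<close> connects the two descriptions.\<close>

definition rees :: "('a, 'b) ring_scheme \<Rightarrow> (int \<Rightarrow> 'a set) \<Rightarrow> (int \<Rightarrow> 'a) ring"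
  where "rees B F = (Laurent B)\<lparr>carrier := {f \<in> carrier (Laurent B). \<forall>n. f n \<in> F n}\<rparr>"

lemma rees_simps [simp]:
  "mult (rees B F) = mult (Laurent B)"
  "add (rees B F) = add (Laurent B)"
  "one (rees B F) = one (Laurent B)"
  "zero (rees B F) = zero (Laurent B)"
  by (simp_all add: rees_def)

lemma mem_rees_iff: "f \<in> carrier (rees B F) \<longleftrightarrow> f \<in> carrier (Laurent B) \<and> (\<forall>n. f n \<in> F n)"
  by (simp add: rees_def)

context int_filtration
begin

text \<open>Keeps the degrees \<open>int (Suc n)\<close> in the form in which the associated graded ring uses them.\<close>
declare of_nat_Suc [simp del]

lemma F_zero: "\<zero> \<in> F n"
  using F_ideal additive_subgroup.zero_closed ideal.axioms(1) by blast

lemma F_add: "\<lbrakk>a \<in> F n; b \<in> F n\<rbrakk> \<Longrightarrow> a \<oplus> b \<in> F n"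
  using F_ideal additive_subgroup.a_closed ideal.axioms(1) by metis

lemma F_carrier: "a \<in> F n \<Longrightarrow> a \<in> carrier B"
  using F_ideal ideal.Icarr by metis

lemma lterm_mem_rees_iff: "a \<in> carrier B \<Longrightarrow> lterm B a n \<in> carrier (rees B F) \<longleftrightarrow> a \<in> F n"
  using F_zero by (auto simp: mem_rees_iff) (auto simp: lterm_def split: if_splits)

lemma subring_rees: "subring (carrier (rees B F)) (Laurent B)"
proof -
  interpret L: cring "Laurent B" by (rule Laurent_cring)
  show ?thesis
  proof (rule L.subringI)
    show "carrier (rees B F) \<subseteq> carrier (Laurent B)" by (auto simp: mem_rees_iff)
    have one: "lterm B a 0 \<in> carrier (rees B F)" if "a \<in> carrier B" for a
      using that by (simp add: lterm_mem_rees_iff F_nonpos)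
    then show "\<one>\<^bsub>Laurent B\<^esub> \<in> carrier (rees B F)" by (simp add: Laurent_one)
    show mult: "f \<otimes>\<^bsub>Laurent B\<^esub> g \<in> carrier (rees B F)"
      if "f \<in> carrier (rees B F)" "g \<in> carrier (rees B F)" for f g
    proof -
      have "(f \<otimes>\<^bsub>Laurent B\<^esub> g) n \<in> F n" for n
      proof -
        have "(f \<otimes>\<^bsub>Laurent B\<^esub> g) n = (\<Oplus>i\<in>{i. f i \<noteq> \<zero>}. f i \<otimes> g (n - i))"
          using that by (intro Laurent_mult) (auto simp: mem_rees_iff Laurent_finite)
        also have "\<dots> \<in> F n"
        proof (rule ideal.finsum_mem[OF F_ideal])
          fix i
          show "f i \<otimes> g (n - i) \<in> F n"
            using F_mult[of "f i" i "g (n - i)" "n - i"] that by (simp add: mem_rees_iff)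
        qed
        finally show ?thesis .
      qed
      then show ?thesis using that by (simp add: mem_rees_iff)
    qed
    show "f \<oplus>\<^bsub>Laurent B\<^esub> g \<in> carrier (rees B F)"
      if "f \<in> carrier (rees B F)" "g \<in> carrier (rees B F)" for f g
      using that by (simp add: mem_rees_iff) (simp add: Laurent_add F_add)
    fix f assume f: "f \<in> carrier (rees B F)"
    have "\<ominus>\<^bsub>Laurent B\<^esub> \<one>\<^bsub>Laurent B\<^esub> = lterm B (\<ominus> \<one>) 0"
      by (rule L.minus_equality)
        (simp_all add: Laurent_one lterm_add l_neg, simp add: Laurent_zero lterm_def)
    then have "lterm B (\<ominus> \<one>) 0 \<otimes>\<^bsub>Laurent B\<^esub> f = \<ominus>\<^bsub>Laurent B\<^esub> f"
      using f L.l_minus[of "\<one>\<^bsub>Laurent B\<^esub>" f] by (simp add: mem_rees_iff)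
    then show "\<ominus>\<^bsub>Laurent B\<^esub> f \<in> carrier (rees B F)"
      using mult[OF one f, of "\<ominus> \<one>"] by simp
  qed
qed

lemma rees_cring: "cring (rees B F)"
proof -
  interpret L: cring "Laurent B" by (rule Laurent_cring)
  have "cring ((Laurent B)\<lparr>carrier := carrier (rees B F)\<rparr>)"
    using L.subcringI'[OF subring_rees] L.subcring_iff[OF subringE(1)[OF subring_rees]] by simp
  then show ?thesis by (simp add: rees_def)
qed

text \<open>Terms of degree at most 0 are constants times powers of \<open>1/t\<close>; all other
  nonzero terms are among the generators. The restriction to \<open>a \<noteq> \<zero>\<close> makes
  the third hypothesis vacuous for \<open>A[1/t]\<close>, whose filtration vanishes in positive
  degrees and where \<open>H\<close> contains \<open>1/t\<close> alone.\<close>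

lemma rees_eq_adjoin:
  assumes "H \<subseteq> carrier (rees B F)" and "lterm B \<one> (-1) \<in> H"
    and "\<And>a n. \<lbrakk>1 \<le> n; a \<in> F n; a \<noteq> \<zero>\<rbrakk> \<Longrightarrow> lterm B a n \<in> H"
  shows "adjoin B H = rees B F"
proof -
  interpret L: cring "Laurent B" by (rule Laurent_cring)
  let ?H = "(\<lambda>a. lterm B a 0) ` carrier B \<union> H"
  let ?K = "generate_ring (Laurent B) ?H"
  have H: "?H \<subseteq> carrier (rees B F)"
    using assms(1) by (auto simp: lterm_mem_rees_iff F_nonpos)
  then have H': "?H \<subseteq> carrier (Laurent B)" by (auto simp: mem_rees_iff)
  note K = L.generate_ring_is_subring[OF H']
  have neg: "lterm B \<one> (- int k) \<in> ?K" for k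
  proof (induct k)
    case 0
    show ?case using subringE(3)[OF K] by (simp add: Laurent_one)
  next
    case (Suc k)
    have "lterm B \<one> (-1) \<in> ?K" using assms(2) by (auto intro: generate_ring.incl)
    from subringE(6)[OF K this Suc] show ?case by (simp add: lterm_mult_lterm of_nat_Suc algebra_simps)
  qed
  have lterm: "lterm B a n \<in> ?K" if "a \<in> F n" "a \<noteq> \<zero>" for a n
  proof (cases "1 \<le> n")
    case True
    then show ?thesis using assms(3) that by (auto intro: generate_ring.incl)
  next
    case False
    have a: "a \<in> carrier B" using that F_carrier by auto
    then have "lterm B a 0 \<in> ?K" by (auto intro: generate_ring.incl)
    from subringE(6)[OF K this neg[of "nat (- n)"]] show ?thesis
      using a False by (simp add: lterm_mult_lterm)
  qed
  have "(\<forall>n. f n \<in> F n) \<longrightarrow> f \<in> ?K" if "f \<in> carrier (Laurent B)" for f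
    using that
  proof (induct rule: Laurent_induct)
    case zero
    show ?case using subringE(2)[OF K] by simp
  next
    case (add a n g)
    show ?case
    proof
      assume *: "\<forall>k. (lterm B a n \<oplus>\<^bsub>Laurent B\<^esub> g) k \<in> F k"
      have "g k \<in> F k" for k
        using *[rule_format, of k] add(2,4) F_zero by (cases "k = n") (simp_all add: Laurent_add lterm_def)
      moreover have "a \<in> F n" using *[rule_format, of n] add by (simp add: Laurent_add lterm_def)
      ultimately show "lterm B a n \<oplus>\<^bsub>Laurent B\<^esub> g \<in> ?K"
        using add lterm by (intro subringE(7)[OF K]) auto
    qed
  qed
  then have "carrier (rees B F) \<subseteq> ?K" by (auto simp: mem_rees_iff)
  moreover have "?K \<subseteq> carrier (rees B F)"
    by (rule L.generate_ring_min_subring1[OF H' subring_rees H])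
  ultimately have "?K = carrier (rees B F)" by auto
  then show ?thesis by (simp add: adjoin_def rees_def)
qed

text \<open>The factors are cosets of \<open>F (i + 1)\<close> and \<open>F (j + 1)\<close>, not of
  the ideal \<open>F (i + j + 1)\<close> in which the product is formed. The product is still a
  single coset: changing representatives alters it by
  \<open>u \<otimes> v \<oplus> u \<otimes> b \<oplus> a \<otimes> v\<close>, and each summand has a
  factor of raised degree.\<close>

lemma rcoset_mult_F:
  assumes "a \<in> F (int i)" "b \<in> F (int j)"
  shows "rcoset_mult B (F (int (Suc (i + j)))) (F (int (Suc i)) +> a) (F (int (Suc j)) +> b) =
    F (int (Suc (i + j))) +> (a \<otimes> b)"
proof -
  let ?I = "F (int (Suc (i + j)))"
  have eq: "?I +> (x \<otimes> y) = ?I +> (a \<otimes> b)"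
    if "x \<in> F (int (Suc i)) +> a" "y \<in> F (int (Suc j)) +> b" for x y
  proof -
    from that obtain u v where uv: "u \<in> F (int (Suc i))" "x = u \<oplus> a"
      "v \<in> F (int (Suc j))" "y = v \<oplus> b"
      by (auto simp: a_r_coset_def')
    note carr = F_carrier[OF assms(1)] F_carrier[OF assms(2)] F_carrier[OF uv(1)] F_carrier[OF uv(3)]
    have "u \<in> F (int i)" using uv(1) F_antimono[of "int i" "int (Suc i)"] by auto
    then have "u \<otimes> v \<in> ?I" using F_mult[OF _ uv(3), of u "int i"] by (simp add: algebra_simps of_nat_Suc)
    moreover have "u \<otimes> b \<in> ?I" using F_mult[OF uv(1) assms(2)] by (simp add: algebra_simps of_nat_Suc)
    moreover have "a \<otimes> v \<in> ?I" using F_mult[OF assms(1) uv(3)] by (simp add: algebra_simps of_nat_Suc)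
    ultimately have "u \<otimes> v \<oplus> u \<otimes> b \<oplus> a \<otimes> v \<in> ?I" by (simp add: F_add)
    moreover have "x \<otimes> y \<ominus> a \<otimes> b = u \<otimes> v \<oplus> u \<otimes> b \<oplus> a \<otimes> v"
      using carr unfolding uv(2,4)
      by (simp add: l_distr r_distr minus_eq a_assoc r_neg) (simp add: a_comm)
    ultimately show ?thesis
      using carr uv(2,4) by (subst quotient_eq_iff_same_a_r_cos[OF F_ideal, symmetric]) auto
  qed
  have self: "a \<in> F (int (Suc i)) +> a" "b \<in> F (int (Suc j)) +> b"
    using F_zero F_carrier[OF assms(1)] F_carrier[OF assms(2)]
    by (auto simp: a_r_coset_def' intro!: bexI[of _ \<zero>])
  have ne: "F (int (Suc i)) +> a \<noteq> {}" "F (int (Suc j)) +> b \<noteq> {}" using self by auto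
  have "(\<Union>y\<in>F (int (Suc j)) +> b. ?I +> (x \<otimes> y)) = ?I +> (a \<otimes> b)"
    if "x \<in> F (int (Suc i)) +> a" for x
    by (rule SUP_eq_const[OF ne(2)]) (rule eq[OF that])
  then show ?thesis unfolding rcoset_mult_def by (rule SUP_eq_const[OF ne(1)])
qed

text \<open>Coefficients in negative degrees are dropped.\<close>

definition initial :: "(int \<Rightarrow> 'a) \<Rightarrow> nat \<Rightarrow> 'a set"
  where "initial f n = F (int (Suc n)) +> f (int n)"

abbreviation "gr \<equiv> assoc_graded B (\<lambda>n. F (int n))"

lemma coset_eq_F_iff: "a \<in> carrier B \<Longrightarrow> F n +> a = F n \<longleftrightarrow> a \<in> F n"
  using ideal.rcos_const_imp_mem[OF F_ideal] a_rcos_zero[OF F_ideal] by blast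

lemma initial_image: "initial ` carrier (rees B F) = carrier gr"
proof
  show "initial ` carrier (rees B F) \<subseteq> carrier gr"
  proof
    fix x assume "x \<in> initial ` carrier (rees B F)"
    then obtain f where f: "f \<in> carrier (Laurent B)" "\<And>n. f n \<in> F n" "x = initial f"
      by (auto simp: mem_rees_iff)
    have "finite (int -` {n. f n \<noteq> \<zero>})"
      using Laurent_finite[OF f(1)] by (rule finite_vimageI) simp
    moreover have "{n. x n \<noteq> F (int (Suc n))} \<subseteq> int -` {n. f n \<noteq> \<zero>}"
    proof
      fix n assume "n \<in> {n. x n \<noteq> F (int (Suc n))}"
      then show "n \<in> int -` {n. f n \<noteq> \<zero>}"
        using a_rcos_zero[OF F_ideal F_zero] f(3) by (auto simp: initial_def)
    qed
    ultimately have "finite {n. x n \<noteq> F (int (Suc n))}" by (rule rev_finite_subset)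
    then show "x \<in> carrier gr" using f by (auto simp: assoc_graded_def initial_def)
  qed
  show "carrier gr \<subseteq> initial ` carrier (rees B F)"
  proof
    fix x assume "x \<in> carrier gr"
    then have x: "\<And>n. \<exists>a\<in>F (int n). x n = F (int (Suc n)) +> a" "finite {n. x n \<noteq> F (int (Suc n))}"
      by (auto simp: assoc_graded_def)
    have "\<forall>n. \<exists>a. a \<in> F (int n) \<and> x n = F (int (Suc n)) +> a" using x(1) by blast
    from choice[OF this] obtain a
      where a: "\<And>n. a n \<in> F (int n)" "\<And>n. x n = F (int (Suc n)) +> a n"
      by blast
    \<comment> \<open>Where the coset is zero the representative must be \<open>\<zero>\<close>: the
      chosen \<open>a n\<close> may be nonzero for infinitely many \<open>n\<close>.\<close>
    define f where "f k = (if 0 \<le> k \<and> x (nat k) \<noteq> F (int (Suc (nat k))) then a (nat k) else \<zero>)" for k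
    have "{k. f k \<noteq> \<zero>} \<subseteq> int ` {n. x n \<noteq> F (int (Suc n))}"
    proof
      fix k assume "k \<in> {k. f k \<noteq> \<zero>}"
      then show "k \<in> int ` {n. x n \<noteq> F (int (Suc n))}"
        by (intro image_eqI[of _ _ "nat k"]) (auto simp: f_def split: if_splits)
    qed
    then have "finite {k. f k \<noteq> \<zero>}" using x(2) by (meson finite_imageI finite_subset)
    moreover have "f k \<in> F k" for k using a(1)[of "nat k"] F_zero by (cases "0 \<le> k") (simp_all add: f_def)
    moreover from this have "f k \<in> carrier B" for k by (rule F_carrier)
    ultimately have "f \<in> carrier (rees B F)" by (simp add: mem_rees_iff mem_Laurent_iff)
    moreover have "x = initial f"
      using a(2) a_rcos_zero[OF F_ideal F_zero] by (simp add: fun_eq_iff initial_def f_def)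
    ultimately show "x \<in> initial ` carrier (rees B F)" by blast
  qed
qed

lemma initial_mult:
  assumes "f \<in> carrier (rees B F)" "g \<in> carrier (rees B F)"
  shows "initial (f \<otimes>\<^bsub>Laurent B\<^esub> g) = initial f \<otimes>\<^bsub>gr\<^esub> initial g"
proof
  fix n
  have f: "f \<in> carrier (Laurent B)" "\<And>n. f n \<in> F n" and g: "g \<in> carrier (Laurent B)" "\<And>n. g n \<in> F n"
    using assms by (simp_all add: mem_rees_iff)
  let ?I = "F (int (Suc n))"
  have zero_Quot: "\<zero>\<^bsub>B Quot ?I\<^esub> = ?I" by (simp add: FactRing_def)
  interpret I: ideal ?I B by (rule F_ideal)
  interpret Q: cring "B Quot ?I" by (rule I.quotient_is_cring) (rule is_cring)
  interpret h: ring_hom_cring B "B Quot ?I" "(+>) ?I" by (rule I.rcos_ring_hom_cring) (rule is_cring)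
  \<comment> \<open>Large enough for the Laurent product, and containing the degrees
    \<open>0..n\<close> over which the graded product is summed.\<close>
  define K where "K = {i. f i \<noteq> \<zero>} \<union> int ` {..n}"
  have K: "finite K" "{i. f i \<noteq> \<zero>} \<subseteq> K" "int ` {..n} \<subseteq> K"
    using Laurent_finite[OF f(1)] by (auto simp: K_def)
  \<comment> \<open>This is why negative coefficients may be dropped: for \<open>i < 0\<close> the
    cofactor has degree above \<open>n\<close>, for \<open>i > n\<close> the factor
    \<open>f i\<close> has, and either way the product lies in \<open>F (n + 1)\<close>.\<close>
  have zero: "?I +> (f i \<otimes> g (int n - i)) = \<zero>\<^bsub>B Quot ?I\<^esub>" if "i \<notin> int ` {..n}" for i
  proof -
    have "i < 0 \<or> int n < i"
    proof (rule ccontr)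
      assume "\<not> (i < 0 \<or> int n < i)"
      then have "i = int (nat i)" "nat i \<le> n" by auto
      then show False using that by blast
    qed
    then have "f i \<otimes> g (int n - i) \<in> ?I"
    proof
      assume "i < 0"
      then have "g (int n - i) \<in> ?I"
        using g(2)[of "int n - i"] F_antimono[of "int (Suc n)" "int n - i"] by auto
      then show ?thesis using f(1) by (simp add: I.I_l_closed)
    next
      assume "int n < i"
      then have "f i \<in> ?I" using f(2)[of i] F_antimono[of "int (Suc n)" i] by auto
      then show ?thesis using g(1) by (simp add: I.I_r_closed)
    qed
    then show ?thesis unfolding zero_Quot by (rule a_rcos_zero[OF F_ideal])
  qed
  have "initial (f \<otimes>\<^bsub>Laurent B\<^esub> g) n = ?I +> (\<Oplus>i\<in>K. f i \<otimes> g (int n - i))"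
    by (simp only: initial_def Laurent_mult[OF K(1,2) f(1) g(1)])
  also have "\<dots> = (\<Oplus>\<^bsub>B Quot ?I\<^esub>i\<in>K. ?I +> (f i \<otimes> g (int n - i)))"
    using h.hom_finsum[of "\<lambda>i. f i \<otimes> g (int n - i)" K] f(1) g(1)
    by (simp add: Pi_iff comp_def del: h.hom_mult h.hom_finsum)
  also have "\<dots> = (\<Oplus>\<^bsub>B Quot ?I\<^esub>i\<in>int ` {..n}. ?I +> (f i \<otimes> g (int n - i)))"
    using K zero f(1) g(1)
    by (intro Q.add.finprod_mono_neutral_cong_right) (auto simp del: h.hom_mult)
  also have "\<dots> = (\<Oplus>\<^bsub>B Quot ?I\<^esub>i\<in>{..n}. ?I +> (f (int i) \<otimes> g (int n - int i)))"
    using f(1) g(1) by (intro Q.add.finprod_reindex) (auto simp: inj_on_def simp del: h.hom_mult)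
  also have "\<dots> = (\<Oplus>\<^bsub>B Quot ?I\<^esub>i\<in>{..n}. rcoset_mult B ?I (initial f i) (initial g (n - i)))"
  proof (rule Q.add.finprod_cong'[symmetric])
    fix i assume "i \<in> {..n}"
    then have "i \<le> n" by simp
    then show "rcoset_mult B ?I (initial f i) (initial g (n - i)) =
        ?I +> (f (int i) \<otimes> g (int n - int i))"
      using rcoset_mult_F[OF f(2)[of "int i"] g(2)[of "int (n - i)"]]
      by (simp add: initial_def of_nat_diff del: h.hom_mult)
  qed (use f(1) g(1) in \<open>auto simp del: h.hom_mult\<close>)
  also have "\<dots> = (initial f \<otimes>\<^bsub>gr\<^esub> initial g) n"
    by (simp add: assoc_graded_def)
  finally show "initial (f \<otimes>\<^bsub>Laurent B\<^esub> g) n = (initial f \<otimes>\<^bsub>gr\<^esub> initial g) n" .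
qed

lemma initial_hom: "initial \<in> ring_hom (rees B F) gr"
proof (rule ring_hom_memI)
  fix f g assume *: "f \<in> carrier (rees B F)" "g \<in> carrier (rees B F)"
  show "initial f \<in> carrier gr" using * initial_image by blast
  show "initial (f \<otimes>\<^bsub>rees B F\<^esub> g) = initial f \<otimes>\<^bsub>gr\<^esub> initial g" using * by (simp add: initial_mult)
  show "initial (f \<oplus>\<^bsub>rees B F\<^esub> g) = initial f \<oplus>\<^bsub>gr\<^esub> initial g"
    using * ideal.a_rcos_sum[OF F_ideal]
    by (simp add: initial_def fun_eq_iff assoc_graded_def Laurent_add mem_rees_iff)
next
  show "initial \<one>\<^bsub>rees B F\<^esub> = \<one>\<^bsub>gr\<^esub>"
    using a_rcos_zero[OF F_ideal F_zero]
    by (auto simp: initial_def fun_eq_iff assoc_graded_def Laurent_one lterm_def)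
qed

lemma initial_zero: "initial \<zero>\<^bsub>Laurent B\<^esub> = \<zero>\<^bsub>gr\<^esub>"
  using a_rcos_zero[OF F_ideal F_zero]
  by (simp add: initial_def fun_eq_iff assoc_graded_def Laurent_zero)

text \<open>The ring axioms are inherited along the surjection from the Rees ring, so that associativity
  of the convolution of cosets need not be checked directly.\<close>

lemma gr_cring: "cring gr"
proof -
  interpret R: cring "rees B F" by (rule rees_cring)
  have "gr\<lparr>carrier := initial ` carrier (rees B F), zero := initial \<zero>\<^bsub>rees B F\<^esub>\<rparr> = gr"
    by (simp add: initial_image initial_zero)
  then have "ring gr" using R.ring_hom_imp_img_ring[OF initial_hom] by simp
  then interpret G: ring gr .
  have "x \<otimes>\<^bsub>gr\<^esub> y = y \<otimes>\<^bsub>gr\<^esub> x" if "x \<in> carrier gr" "y \<in> carrier gr" for x y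
  proof -
    from that obtain f g where *: "f \<in> carrier (rees B F)" "g \<in> carrier (rees B F)"
      "x = initial f" "y = initial g"
      unfolding initial_image[symmetric] by blast
    have "f \<otimes>\<^bsub>Laurent B\<^esub> g = g \<otimes>\<^bsub>Laurent B\<^esub> f" using R.m_comm[OF *(1,2)] by simp
    then show ?thesis
      unfolding *(3,4) using initial_mult[OF *(1,2)] initial_mult[OF *(2,1)] by simp
  qed
  then have "Group.comm_monoid gr" by (rule G.monoid_comm_monoidI)
  then show ?thesis by (intro cring.intro G.ring_axioms)
qed

end

text \<open>The support can only shrink under \<open>h\<close>, so the support of \<open>f\<close>
  still indexes the product of the images.\<close>

lemma Laurent_map_hom:
  assumes "ring_hom_cring A B h"
  shows "(\<lambda>f. h \<circ> f) \<in> ring_hom (Laurent A) (Laurent B)"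
proof -
  interpret h: ring_hom_cring A B h by fact
  have supp: "{n. (h \<circ> f) n \<noteq> \<zero>\<^bsub>B\<^esub>} \<subseteq> {n. f n \<noteq> \<zero>\<^bsub>A\<^esub>}" for f by auto
  have closed: "h \<circ> f \<in> carrier (Laurent B)" if "f \<in> carrier (Laurent A)" for f
    using that finite_subset[OF supp h.R.Laurent_finite[OF that]]
    by (simp add: h.S.mem_Laurent_iff)
  show ?thesis
  proof (rule ring_hom_memI)
    fix f g assume *: "f \<in> carrier (Laurent A)" "g \<in> carrier (Laurent A)"
    show "h \<circ> f \<in> carrier (Laurent B)" by (rule closed[OF *(1)])
    show "h \<circ> (f \<oplus>\<^bsub>Laurent A\<^esub> g) = (h \<circ> f) \<oplus>\<^bsub>Laurent B\<^esub> (h \<circ> g)"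
      using * by (simp add: fun_eq_iff h.R.Laurent_add h.S.Laurent_add)
    show "h \<circ> (f \<otimes>\<^bsub>Laurent A\<^esub> g) = (h \<circ> f) \<otimes>\<^bsub>Laurent B\<^esub> (h \<circ> g)"
    proof
      fix n
      let ?K = "{i. f i \<noteq> \<zero>\<^bsub>A\<^esub>}"
      have "(h \<circ> (f \<otimes>\<^bsub>Laurent A\<^esub> g)) n = h (\<Oplus>\<^bsub>A\<^esub>i\<in>?K. f i \<otimes>\<^bsub>A\<^esub> g (n - i))"
        using * h.R.Laurent_finite by (simp add: h.R.Laurent_mult[of ?K])
      also have "\<dots> = (\<Oplus>\<^bsub>B\<^esub>i\<in>?K. (h \<circ> f) i \<otimes>\<^bsub>B\<^esub> (h \<circ> g) (n - i))"
        using * by (subst h.hom_finsum) (auto simp: comp_def intro!: h.S.add.finprod_cong')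
      also have "\<dots> = ((h \<circ> f) \<otimes>\<^bsub>Laurent B\<^esub> (h \<circ> g)) n"
        using * supp[of f] closed h.R.Laurent_finite by (intro h.S.Laurent_mult[symmetric])
      finally show "(h \<circ> (f \<otimes>\<^bsub>Laurent A\<^esub> g)) n = ((h \<circ> f) \<otimes>\<^bsub>Laurent B\<^esub> (h \<circ> g)) n" .
    qed
  qed (simp add: h.R.Laurent_one h.S.Laurent_one lterm_def fun_eq_iff)
qed

section \<open>Primes of a localization\<close>

lemma (in ring_hom_cring) hom_Units:
  assumes "u \<in> Units R"
  shows "h u \<in> Units S"
proof -
  obtain v where "v \<in> carrier R" "v \<otimes> u = \<one>" "u \<otimes> v = \<one>"
    using assms by (auto simp: Units_def)
  moreover from this have "h v \<otimes>\<^bsub>S\<^esub> h u = \<one>\<^bsub>S\<^esub> \<and> h u \<otimes>\<^bsub>S\<^esub> h v = \<one>\<^bsub>S\<^esub>"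
    using R.Units_closed[OF assms] hom_mult[of u v] hom_mult[of v u] by (simp del: hom_mult)
  ultimately show ?thesis using assms by (auto simp: Units_def)
qed

lemma carrier_FactRing: "carrier (R Quot I) = (+>\<^bsub>R\<^esub>) I ` carrier R"
  by (auto simp: FactRing_simps)

text \<open>The assumptions say that \<open>S\<close> is a localization of \<open>h ` R\<close> at \<open>h ` M\<close>, with all elements of
  \<open>h ` M\<close> already invertible in \<open>S\<close>.\<close>

locale localizing_hom = ring_hom_cring R S h for R (structure) and S (structure) and h +
  fixes M
  assumes M_subset: "M \<subseteq> carrier R"
    and M_one: "\<one> \<in> M"
    and M_mult: "\<lbrakk>s \<in> M; t \<in> M\<rbrakk> \<Longrightarrow> s \<otimes> t \<in> M"
    and M_Units: "s \<in> M \<Longrightarrow> h s \<in> Units S"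
    and M_surj: "y \<in> carrier S \<Longrightarrow> \<exists>s\<in>M. \<exists>r\<in>carrier R. h s \<otimes>\<^bsub>S\<^esub> y = h r"
begin

text \<open>For an ideal \<open>P\<close> this is the ideal of \<open>S\<close> generated by the
  image of \<open>P\<close>, written with denominators cleared.\<close>

definition extension :: "'a set \<Rightarrow> 'c set"
  where "extension P = {y \<in> carrier S. \<exists>s\<in>M. \<exists>r\<in>P. h s \<otimes>\<^bsub>S\<^esub> y = h r}"

definition contraction :: "'c set \<Rightarrow> 'a set"
  where "contraction Q = {r \<in> carrier R. h r \<in> Q}"

definition relevant_Spec :: "'a set set"
  where "relevant_Spec = {P \<in> Spec R. a_kernel R S h \<subseteq> P \<and> P \<inter> M = {}}"

lemma M_carr [simp]: "s \<in> M \<Longrightarrow> s \<in> carrier R"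
  using M_subset by auto

text \<open>An ideal that contains the kernel is a union of fibres of \<open>h\<close>, so
  membership in it can be decided from images.\<close>

lemma mem_of_hom_eq:
  assumes "ideal P R" "a_kernel R S h \<subseteq> P" "h x = h y" "x \<in> carrier R" "y \<in> P"
  shows "x \<in> P"
proof -
  interpret P: ideal P R by fact
  have y: "y \<in> carrier R" using assms(5) by (rule P.Icarr)
  have "h (x \<ominus> y) = h x \<ominus>\<^bsub>S\<^esub> h y" using assms(4) y by (simp add: a_minus_def)
  then have "h (x \<ominus> y) = \<zero>\<^bsub>S\<^esub>" using assms(3) y by (simp add: S.r_neg a_minus_def)
  then have "x \<ominus> y \<in> a_kernel R S h" using assms(4) y unfolding a_kernel_def' by simp
  then have "(x \<ominus> y) \<oplus> y \<in> P" using assms(2,5) P.a_closed by blast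
  moreover have "(x \<ominus> y) \<oplus> y = x" using assms(4) y by (simp add: a_minus_def R.a_assoc R.l_neg)
  ultimately show ?thesis by simp
qed

lemma mem_extensionI:
  "\<lbrakk>y \<in> carrier S; s \<in> M; r \<in> P; h s \<otimes>\<^bsub>S\<^esub> y = h r\<rbrakk> \<Longrightarrow> y \<in> extension P"
  by (auto simp: extension_def)

lemma extension_mono: "P \<subseteq> P' \<Longrightarrow> extension P \<subseteq> extension P'"
  by (auto simp: extension_def)

lemma ideal_extension:
  assumes "ideal P R"
  shows "ideal (extension P) S"
proof -
  interpret P: ideal P R by fact
  have mult: "x \<otimes>\<^bsub>S\<^esub> y \<in> extension P" if "y \<in> extension P" "x \<in> carrier S" for x y
  proof -
    from that(1) obtain s r where *: "y \<in> carrier S" "s \<in> M" "r \<in> P" "h s \<otimes>\<^bsub>S\<^esub> y = h r"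
      by (auto simp: extension_def)
    from M_surj[OF that(2)] obtain t a where
      t: "t \<in> M" "a \<in> carrier R" "h t \<otimes>\<^bsub>S\<^esub> x = h a" by blast
    have "h (t \<otimes> s) \<otimes>\<^bsub>S\<^esub> (x \<otimes>\<^bsub>S\<^esub> y) = (h t \<otimes>\<^bsub>S\<^esub> x) \<otimes>\<^bsub>S\<^esub> (h s \<otimes>\<^bsub>S\<^esub> y)"
      using *(1,2) t(1) that(2) by (simp add: S.m_ac)
    also have "\<dots> = h (a \<otimes> r)" using * t P.Icarr by simp
    finally show ?thesis
      using * t that(2) by (intro mem_extensionI[of _ "t \<otimes> s" "a \<otimes> r"] P.I_l_closed M_mult) auto
  qed
  show ?thesis
  proof (rule idealI[OF S.ring_axioms])
    show "subgroup (extension P) (add_monoid S)"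
    proof (rule S.add.subgroupI)
      show "extension P \<subseteq> carrier S" by (auto simp: extension_def)
      have "\<zero>\<^bsub>S\<^esub> \<in> extension P"
        using M_one P.zero_closed by (intro mem_extensionI[of _ \<one> \<zero>]) auto
      then show "extension P \<noteq> {}" by auto
      fix x y assume xy: "x \<in> extension P" "y \<in> extension P"
      then have "(\<ominus>\<^bsub>S\<^esub> \<one>\<^bsub>S\<^esub>) \<otimes>\<^bsub>S\<^esub> x \<in> extension P" by (intro mult) simp_all
      then show "\<ominus>\<^bsub>S\<^esub> x \<in> extension P" using xy by (simp add: S.l_minus extension_def)
      obtain s r t a where *: "x \<in> carrier S" "s \<in> M" "r \<in> P" "h s \<otimes>\<^bsub>S\<^esub> x = h r"
        "y \<in> carrier S" "t \<in> M" "a \<in> P" "h t \<otimes>\<^bsub>S\<^esub> y = h a"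
        using xy by (auto simp: extension_def)
      have "h (s \<otimes> t) \<otimes>\<^bsub>S\<^esub> (x \<oplus>\<^bsub>S\<^esub> y) = h t \<otimes>\<^bsub>S\<^esub> (h s \<otimes>\<^bsub>S\<^esub> x) \<oplus>\<^bsub>S\<^esub> h s \<otimes>\<^bsub>S\<^esub> (h t \<otimes>\<^bsub>S\<^esub> y)"
        using *(1,2,5,6) by (simp add: S.r_distr S.m_ac)
      also have "\<dots> = h (t \<otimes> r \<oplus> s \<otimes> a)" using * P.Icarr by simp
      finally show "x \<oplus>\<^bsub>S\<^esub> y \<in> extension P"
        using * by (intro mem_extensionI[of _ "s \<otimes> t" "t \<otimes> r \<oplus> s \<otimes> a"] P.a_closed P.I_l_closed M_mult) auto
    qed
    fix a x assume *: "a \<in> extension P" "x \<in> carrier S"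
    then show "x \<otimes>\<^bsub>S\<^esub> a \<in> extension P" by (rule mult)
    then show "a \<otimes>\<^bsub>S\<^esub> x \<in> extension P" using * by (simp add: extension_def S.m_comm)
  qed
qed

text \<open>Both conditions of \<open>relevant_Spec\<close> enter: containing the kernel brings
  \<open>s \<otimes> x\<close> back into \<open>P\<close>, and avoiding \<open>M\<close> lets
  primality cancel \<open>s\<close>.\<close>

lemma contraction_extension:
  assumes "P \<in> relevant_Spec"
  shows "contraction (extension P) = P"
proof
  interpret P: primeideal P R using assms by (simp add: relevant_Spec_def Spec_def)
  have P: "a_kernel R S h \<subseteq> P" "P \<inter> M = {}" using assms by (auto simp: relevant_Spec_def)
  show "P \<subseteq> contraction (extension P)"
  proof
    fix x assume "x \<in> P"
    moreover from this have "h \<one> \<otimes>\<^bsub>S\<^esub> h x = h x" using P.Icarr by simp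
    ultimately show "x \<in> contraction (extension P)"
      using M_one P.Icarr by (auto simp: contraction_def intro!: mem_extensionI[of _ \<one> x])
  qed
  show "contraction (extension P) \<subseteq> P"
  proof
    fix x assume "x \<in> contraction (extension P)"
    then obtain s r where *: "x \<in> carrier R" "s \<in> M" "r \<in> P" "h s \<otimes>\<^bsub>S\<^esub> h x = h r"
      by (auto simp: contraction_def extension_def)
    then have "s \<otimes> x \<in> P" using P by (intro mem_of_hom_eq[OF P.is_ideal, of "s \<otimes> x" r]) auto
    then show "x \<in> P" using P.I_prime[of s x] * P(2) by auto
  qed
qed

text \<open>Elements of \<open>M\<close> become units of \<open>S\<close>, so clearing a denominator
  is reversible inside an ideal of \<open>S\<close>.\<close>

lemma extension_contraction:
  assumes "ideal Q S"
  shows "extension (contraction Q) = Q"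
proof
  interpret Q: ideal Q S by fact
  show "extension (contraction Q) \<subseteq> Q"
  proof
    fix y assume "y \<in> extension (contraction Q)"
    then obtain s r where *: "y \<in> carrier S" "s \<in> M" "h r \<in> Q" "h s \<otimes>\<^bsub>S\<^esub> y = h r"
      by (auto simp: contraction_def extension_def)
    note u = M_Units[OF *(2)]
    have "y = inv\<^bsub>S\<^esub> h s \<otimes>\<^bsub>S\<^esub> (h s \<otimes>\<^bsub>S\<^esub> y)"
      using *(1,2) u by (simp add: S.m_assoc[symmetric])
    also have "\<dots> \<in> Q" using * u by (simp add: Q.I_l_closed)
    finally show "y \<in> Q" .
  qed
  show "Q \<subseteq> extension (contraction Q)"
  proof
    fix y assume y: "y \<in> Q"
    then obtain s r where "s \<in> M" "r \<in> carrier R" "h s \<otimes>\<^bsub>S\<^esub> y = h r"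
      using M_surj Q.Icarr by metis
    moreover from this have "h r \<in> Q" using y Q.I_l_closed[of y "h s"] by simp
    ultimately show "y \<in> extension (contraction Q)"
      using y Q.Icarr by (intro mem_extensionI[of _ s r]) (auto simp: contraction_def)
  qed
qed

lemma primeideal_extension:
  assumes "P \<in> relevant_Spec"
  shows "primeideal (extension P) S"
proof (rule primeidealI)
  interpret P: primeideal P R using assms by (simp add: relevant_Spec_def Spec_def)
  have P: "a_kernel R S h \<subseteq> P" "P \<inter> M = {}" using assms by (auto simp: relevant_Spec_def)
  show "ideal (extension P) S" by (rule ideal_extension) (rule P.is_ideal)
  show "cring S" by (rule S.is_cring)
  have "\<one> \<notin> contraction (extension P)"
    using P.one_imp_carrier P.I_notcarr contraction_extension[OF assms] by auto
  then show "carrier S \<noteq> extension P" by (auto simp: contraction_def)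
  fix x y assume xy: "x \<in> carrier S" "y \<in> carrier S" "x \<otimes>\<^bsub>S\<^esub> y \<in> extension P"
  obtain s a where a: "s \<in> M" "a \<in> carrier R" "h s \<otimes>\<^bsub>S\<^esub> x = h a" using M_surj xy by blast
  obtain t b where b: "t \<in> M" "b \<in> carrier R" "h t \<otimes>\<^bsub>S\<^esub> y = h b" using M_surj xy by blast
  have "h (a \<otimes> b) = h (s \<otimes> t) \<otimes>\<^bsub>S\<^esub> (x \<otimes>\<^bsub>S\<^esub> y)"
    using a b xy(1,2) by (simp add: a(3)[symmetric] b(3)[symmetric] S.m_ac)
  also have "\<dots> \<in> extension P"
    using ideal.I_l_closed[OF ideal_extension[OF P.is_ideal] xy(3)] a(1) b(1) by simp
  finally have "a \<otimes> b \<in> contraction (extension P)" using a b by (simp add: contraction_def)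
  then have "a \<otimes> b \<in> P" by (simp only: contraction_extension[OF assms])
  then show "x \<in> extension P \<or> y \<in> extension P"
    using P.I_prime[OF a(2) b(2)] mem_extensionI[OF xy(1) a(1) _ a(3)]
      mem_extensionI[OF xy(2) b(1) _ b(3)] by blast
qed

lemma contraction_mem_relevant_Spec:
  assumes "primeideal Q S"
  shows "contraction Q \<in> relevant_Spec"
proof -
  interpret Q: primeideal Q S by fact
  have "primeideal (contraction Q) R"
    unfolding contraction_def by (rule ring.primeideal_vimage) (rule R.is_cring, fact)
  moreover have "a_kernel R S h \<subseteq> contraction Q"
    using Q.zero_closed unfolding a_kernel_def' by (auto simp: contraction_def)
  moreover have "h s \<notin> Q" if "s \<in> M" for s
  proof
    assume "h s \<in> Q"
    then have "inv\<^bsub>S\<^esub> h s \<otimes>\<^bsub>S\<^esub> h s \<in> Q"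
      using S.Units_inv_closed[OF M_Units[OF that]] by (rule Q.I_l_closed)
    then have "\<one>\<^bsub>S\<^esub> \<in> Q" by (simp only: S.Units_l_inv[OF M_Units[OF that]])
    then show False using Q.one_imp_carrier Q.I_notcarr by blast
  qed
  ultimately show ?thesis by (auto simp: relevant_Spec_def Spec_def contraction_def)
qed

theorem inclusion_isomorphic_Spec: "inclusion_isomorphic relevant_Spec (Spec S)"
  unfolding inclusion_isomorphic_def
proof (intro exI conjI ballI)
  show "bij_betw extension relevant_Spec (Spec S)"
  proof (rule bij_betw_byWitness[where f' = contraction])
    show "\<forall>P\<in>relevant_Spec. contraction (extension P) = P" by (simp add: contraction_extension)
    show "\<forall>Q\<in>Spec S. extension (contraction Q) = Q"
      by (auto simp: Spec_def extension_contraction primeideal.axioms(1))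
    show "extension ` relevant_Spec \<subseteq> Spec S" by (auto simp: Spec_def primeideal_extension)
    show "contraction ` Spec S \<subseteq> relevant_Spec"
      by (auto simp: Spec_def contraction_mem_relevant_Spec)
  qed
  fix P Q assume *: "P \<in> relevant_Spec" "Q \<in> relevant_Spec"
  show "P \<subseteq> Q \<longleftrightarrow> extension P \<subseteq> extension Q"
  proof
    assume "extension P \<subseteq> extension Q"
    then have "contraction (extension P) \<subseteq> contraction (extension Q)" by (auto simp: contraction_def)
    then show "P \<subseteq> Q" using * by (simp add: contraction_extension)
  qed (rule extension_mono)
qed

text \<open>Units and cleared denominators survive in a quotient of \<open>S\<close>. Hence the
  correspondence for \<open>G(A_q)\<close> also covers its quotient, with the contraction of
  \<open>J\<close> as the new kernel.\<close>

lemma localizing_hom_quotient: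
  assumes "ideal J S"
  shows "localizing_hom R (S Quot J) ((+>\<^bsub>S\<^esub>) J \<circ> h) M"
proof -
  interpret J: ideal J S by fact
  interpret Q: cring "S Quot J" by (rule J.quotient_is_cring) (rule S.is_cring)
  interpret k: ring_hom_cring S "S Quot J" "(+>\<^bsub>S\<^esub>) J"
    by (rule J.rcos_ring_hom_cring) (rule S.is_cring)
  have hom: "(+>\<^bsub>S\<^esub>) J \<circ> h \<in> ring_hom R (S Quot J)"
    using ring_hom_trans[OF homh k.homh] .
  show ?thesis
  proof (intro localizing_hom.intro ring_hom_cring.intro ring_hom_cring_axioms.intro
      localizing_hom_axioms.intro hom)
    show "((+>\<^bsub>S\<^esub>) J \<circ> h) s \<in> Units (S Quot J)" if "s \<in> M" for s
      using k.hom_Units[OF M_Units[OF that]] by simp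
    show "\<exists>s\<in>M. \<exists>r\<in>carrier R. ((+>\<^bsub>S\<^esub>) J \<circ> h) s \<otimes>\<^bsub>S Quot J\<^esub> y = ((+>\<^bsub>S\<^esub>) J \<circ> h) r"
      if "y \<in> carrier (S Quot J)" for y
    proof -
      from that obtain x where x: "x \<in> carrier S" "y = J +>\<^bsub>S\<^esub> x"
        unfolding carrier_FactRing by blast
      obtain s r where "s \<in> M" "r \<in> carrier R" "h s \<otimes>\<^bsub>S\<^esub> x = h r" using M_surj[OF x(1)] by blast
      moreover from this have "((+>\<^bsub>S\<^esub>) J \<circ> h) s \<otimes>\<^bsub>S Quot J\<^esub> y = ((+>\<^bsub>S\<^esub>) J \<circ> h) r"
        unfolding x(2) comp_def using k.hom_mult[of "h s" x] x(1) by (simp del: k.hom_mult)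
      ultimately show ?thesis by blast
    qed
  qed (use M_subset M_one M_mult R.is_cring Q.is_cring in auto)
qed

lemma a_kernel_quotient:
  assumes "ideal J S"
  shows "a_kernel R (S Quot J) ((+>\<^bsub>S\<^esub>) J \<circ> h) = contraction J"
proof -
  interpret J: ideal J S by fact
  have "J +>\<^bsub>S\<^esub> x = J \<longleftrightarrow> x \<in> J" if "x \<in> carrier S" for x
    using that J.rcos_const_imp_mem S.a_rcos_zero[OF assms] by blast
  then show ?thesis unfolding a_kernel_def' by (auto simp: contraction_def FactRing_def)
qed

end

section \<open>The ring of polynomials in 1/t\<close>

context cring
begin

text \<open>With this filtration \<open>R[1/t]\<close> becomes a Rees ring, too.\<close>

definition nonpos_filtration :: "int \<Rightarrow> 'a set"
  where "nonpos_filtration n = (if n \<le> 0 then carrier R else {\<zero>})"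

lemma int_filtration_nonpos: "int_filtration R nonpos_filtration"
  by (intro int_filtration.intro int_filtration_axioms.intro is_cring)
    (auto simp: nonpos_filtration_def oneideal zeroideal split: if_splits)

lemma poly_t_inv_eq_rees: "poly_t_inv R = rees R nonpos_filtration"
proof -
  interpret N: int_filtration R nonpos_filtration by (rule int_filtration_nonpos)
  show ?thesis unfolding poly_t_inv_def
    by (rule N.rees_eq_adjoin) (auto simp: N.lterm_mem_rees_iff, auto simp: nonpos_filtration_def)
qed

lemma poly_t_inv_cring: "cring (poly_t_inv R)"
  unfolding poly_t_inv_eq_rees by (rule int_filtration.rees_cring) (rule int_filtration_nonpos)

lemma poly_t_inv_simps [simp]:
  "mult (poly_t_inv R) = mult (Laurent R)"
  "add (poly_t_inv R) = add (Laurent R)"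
  "one (poly_t_inv R) = one (Laurent R)"
  "zero (poly_t_inv R) = zero (Laurent R)"
  by (simp_all add: poly_t_inv_eq_rees)

lemma mem_poly_t_inv_iff:
  "f \<in> carrier (poly_t_inv R) \<longleftrightarrow> f \<in> carrier (Laurent R) \<and> (\<forall>n>0. f n = \<zero>)"
proof -
  have "f n \<in> nonpos_filtration n \<longleftrightarrow> (0 < n \<longrightarrow> f n = \<zero>)" if "f \<in> carrier (Laurent R)" for n
    using that by (simp add: nonpos_filtration_def)
  then show ?thesis unfolding poly_t_inv_eq_rees mem_rees_iff by blast
qed

lemma lterm_mem_poly_t_inv: "\<lbrakk>a \<in> carrier R; n \<le> 0\<rbrakk> \<Longrightarrow> lterm R a n \<in> carrier (poly_t_inv R)"
  by (simp add: mem_poly_t_inv_iff) (simp add: lterm_def)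

lemma poly_t_inv_decompose:
  assumes "f \<in> carrier (poly_t_inv R)"
  obtains g where "g \<in> carrier (poly_t_inv R)"
    "f = lterm R (f 0) 0 \<oplus>\<^bsub>Laurent R\<^esub> lterm R \<one> (-1) \<otimes>\<^bsub>Laurent R\<^esub> g"
proof
  \<comment> \<open>Multiplication by \<open>1/t\<close> moves coefficients down by one degree, so
    dividing \<open>f\<close> without its constant term by \<open>1/t\<close> moves them up by
    one.\<close>
  define g where "g = (\<lambda>n. if n \<le> 0 then f (n - 1) else \<zero>)"
  have f: "f \<in> carrier (Laurent R)" "\<And>n. 0 < n \<Longrightarrow> f n = \<zero>"
    using assms by (auto simp: mem_poly_t_inv_iff)
  have "{n. g n \<noteq> \<zero>} \<subseteq> (\<lambda>n. n + 1) ` {n. f n \<noteq> \<zero>}"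
  proof
    fix n assume "n \<in> {n. g n \<noteq> \<zero>}"
    then show "n \<in> (\<lambda>n. n + 1) ` {n. f n \<noteq> \<zero>}"
      by (intro image_eqI[of _ _ "n - 1"]) (auto simp: g_def split: if_splits)
  qed
  then have "finite {n. g n \<noteq> \<zero>}" using Laurent_finite[OF f(1)] by (meson finite_imageI finite_subset)
  then have g: "g \<in> carrier (Laurent R)" using f(1) by (simp add: mem_Laurent_iff g_def)
  then show "g \<in> carrier (poly_t_inv R)" by (simp add: mem_poly_t_inv_iff g_def)
  show "f = lterm R (f 0) 0 \<oplus>\<^bsub>Laurent R\<^esub> lterm R \<one> (-1) \<otimes>\<^bsub>Laurent R\<^esub> g"
    using f g by (auto simp: lterm_mult Laurent_add fun_eq_iff) (auto simp: lterm_def g_def)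
qed

text \<open>This is evaluation at \<open>1/t = 0\<close>: in the absence of positive degrees, only
  the index 0 contributes to the coefficient of degree 0 of a product.\<close>

lemma constant_coeff_hom: "(\<lambda>f. f 0) \<in> ring_hom (poly_t_inv R) R"
proof (rule ring_hom_memI)
  fix f g assume *: "f \<in> carrier (poly_t_inv R)" "g \<in> carrier (poly_t_inv R)"
  then have f: "f \<in> carrier (Laurent R)" "\<And>n. 0 < n \<Longrightarrow> f n = \<zero>"
    and g: "g \<in> carrier (Laurent R)" "\<And>n. 0 < n \<Longrightarrow> g n = \<zero>"
    by (auto simp: mem_poly_t_inv_iff)
  show "f 0 \<in> carrier R" using f by simp
  show "(f \<oplus>\<^bsub>poly_t_inv R\<^esub> g) 0 = f 0 \<oplus> g 0" by (simp add: Laurent_add)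
  let ?K = "insert 0 {i. f i \<noteq> \<zero>}"
  have K: "finite ?K" "{i. f i \<noteq> \<zero>} \<subseteq> ?K" using Laurent_finite[OF f(1)] by auto
  have zero: "f i \<otimes> g (0 - i) = \<zero>" if "i \<noteq> 0" for i
    using that f g by (cases "0 < i") simp_all
  have "(f \<otimes>\<^bsub>Laurent R\<^esub> g) 0 = (\<Oplus>i\<in>?K. f i \<otimes> g (0 - i))"
    by (rule Laurent_mult[OF K f(1) g(1)])
  also have "\<dots> = (\<Oplus>i\<in>{0}. f i \<otimes> g (0 - i))"
    using K(1) zero f(1) g(1) by (intro add.finprod_mono_neutral_cong_right) auto
  finally show "(f \<otimes>\<^bsub>poly_t_inv R\<^esub> g) 0 = f 0 \<otimes> g 0" using f(1) g(1) by simp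
qed (simp add: Laurent_one lterm_def)

text \<open>The right-hand side is the preimage of \<open>q\<close> under evaluation at
  \<open>1/t = 0\<close>, hence an ideal containing the generators. Conversely, every element is its
  constant term plus a multiple of \<open>1/t\<close>.\<close>

lemma q_t_inv_eq:
  assumes "ideal q R"
  shows "q_t_inv R q = {f \<in> carrier (poly_t_inv R). f 0 \<in> q}"
proof
  interpret q: ideal q R by fact
  interpret T: cring "poly_t_inv R" by (rule poly_t_inv_cring)
  let ?G = "(\<lambda>a. lterm R a 0) ` q \<union> {lterm R \<one> (-1)}"
  have G: "?G \<subseteq> carrier (poly_t_inv R)" using q.Icarr by (auto intro!: lterm_mem_poly_t_inv)
  have "ring_hom_ring (poly_t_inv R) R (\<lambda>f. f 0)"
    by (rule ring_hom_ringI2) (rule T.ring_axioms ring_axioms constant_coeff_hom)+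
  then have "ideal {f \<in> carrier (poly_t_inv R). f 0 \<in> q} (poly_t_inv R)"
    using assms by (rule ring_hom_ring.ideal_vimage)
  moreover have "?G \<subseteq> {f \<in> carrier (poly_t_inv R). f 0 \<in> q}"
    using G by (auto simp: lterm_def)
  ultimately show "q_t_inv R q \<subseteq> {f \<in> carrier (poly_t_inv R). f 0 \<in> q}"
    unfolding q_t_inv_def by (rule T.genideal_minimal)
  interpret I: ideal "q_t_inv R q" "poly_t_inv R"
    unfolding q_t_inv_def by (rule T.genideal_ideal[OF G])
  have I: "?G \<subseteq> q_t_inv R q" unfolding q_t_inv_def by (rule T.genideal_self[OF G])
  show "{f \<in> carrier (poly_t_inv R). f 0 \<in> q} \<subseteq> q_t_inv R q"
  proof
    fix f assume "f \<in> {f \<in> carrier (poly_t_inv R). f 0 \<in> q}"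
    then have f: "f \<in> carrier (poly_t_inv R)" "f 0 \<in> q" by auto
    obtain g where g: "g \<in> carrier (poly_t_inv R)"
      "f = lterm R (f 0) 0 \<oplus>\<^bsub>Laurent R\<^esub> lterm R \<one> (-1) \<otimes>\<^bsub>Laurent R\<^esub> g"
      using poly_t_inv_decompose[OF f(1)] .
    have "lterm R (f 0) 0 \<in> q_t_inv R q" "lterm R \<one> (-1) \<otimes>\<^bsub>Laurent R\<^esub> g \<in> q_t_inv R q"
      using I f I.I_r_closed[OF _ g(1), of "lterm R \<one> (-1)"] by auto
    then have "lterm R (f 0) 0 \<oplus>\<^bsub>Laurent R\<^esub> lterm R \<one> (-1) \<otimes>\<^bsub>Laurent R\<^esub> g \<in> q_t_inv R q"
      using I.a_closed by simp
    then show "f \<in> q_t_inv R q" by (simp only: g(2)[symmetric])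
  qed
qed

end

section \<open>The homomorphism from the Rees algebra to the associated graded ring\<close>

locale prime_pair =
  fixes A (structure) and p q
  assumes p_prime: "primeideal p A" and q_prime: "primeideal q A" and p_sub_q: "p \<subseteq> q"

sublocale prime_pair \<subseteq> mult_subset A "carrier A - q"
  by (rule primeideal_mult_subset) (rule q_prime)

sublocale prime_pair \<subseteq> FA: int_filtration A "symbolic_power A p"
  by (rule int_filtration_symbolic_power) (rule p_prime)

sublocale prime_pair \<subseteq> FB: int_filtration "local_at A q"
    "symbolic_power (local_at A q) (local_ext A q p)"
  by (intro int_filtration_symbolic_power primeideal_local_ext p_prime q_prime p_sub_q)

sublocale prime_pair \<subseteq> loc: ring_hom_cring A "local_at A q" "to_local A q"
  using fraction_one_ring_hom
  by (intro ring_hom_cring.intro ring_hom_cring_axioms.intro is_cring FB.is_cring)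
    (simp add: to_local_def[abs_def] local_at_def)

context prime_pair
begin

text \<open>The map \<phi> of the overview, factored through the Rees ring of \<open>A_q\<close>:
  localize each coefficient, then take initial forms.\<close>

definition to_G :: "(int \<Rightarrow> 'a) \<Rightarrow> nat \<Rightarrow> ('a \<times> 'a) set set"
  where "to_G f = FB.initial (to_local A q \<circ> f)"

definition units_set :: "(int \<Rightarrow> 'a) set"
  where "units_set = (\<lambda>s. lterm A s 0) ` (carrier A - q)"

lemma symbolic_Rees_eq: "symbolic_Rees A p = rees A (symbolic_power A p)"
  unfolding symbolic_Rees_def
  by (rule FA.rees_eq_adjoin)
    (auto simp: FA.lterm_mem_rees_iff FA.F_carrier FA.F_nonpos)

lemma symbolic_G_eq: "symbolic_G A p q = FB.gr"
  by (simp add: symbolic_G_def symbolic_filtration_def[abs_def])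

lemma symbolic_Rees_simps [simp]:
  "mult (symbolic_Rees A p) = mult (Laurent A)"
  "add (symbolic_Rees A p) = add (Laurent A)"
  "one (symbolic_Rees A p) = one (Laurent A)"
  "zero (symbolic_Rees A p) = zero (Laurent A)"
  by (simp_all add: symbolic_Rees_eq)

lemma to_local_mem_iff:
  "a \<in> carrier A \<Longrightarrow> to_local A q a \<in> symbolic_power (local_at A q) (local_ext A q p) n
    \<longleftrightarrow> a \<in> symbolic_power A p n"
  unfolding to_local_def
  by (rule fraction_mem_symbolic_power_iff[OF q_prime p_prime p_sub_q _ S_one])

lemma to_G_hom: "to_G \<in> ring_hom (symbolic_Rees A p) (symbolic_G A p q)"
proof -
  have map: "(\<lambda>f. to_local A q \<circ> f) \<in> ring_hom (Laurent A) (Laurent (local_at A q))"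
    by (rule Laurent_map_hom) (rule loc.ring_hom_cring_axioms)
  have "(\<lambda>f. to_local A q \<circ> f) \<in> ring_hom (symbolic_Rees A p)
      (rees (local_at A q) (symbolic_power (local_at A q) (local_ext A q p)))"
    unfolding symbolic_Rees_eq
    using ring_hom_closed[OF map] ring_hom_mult[OF map] ring_hom_add[OF map] ring_hom_one[OF map]
    by (intro ring_hom_memI) (simp_all add: mem_rees_iff to_local_mem_iff)
  from ring_hom_trans[OF this FB.initial_hom] show ?thesis
    by (simp add: symbolic_G_eq to_G_def[abs_def] comp_def)
qed

lemma lterm_mem_symbolic_Rees: "a \<in> carrier A \<Longrightarrow> n \<le> 0 \<Longrightarrow> lterm A a n \<in> carrier (symbolic_Rees A p)"
  by (simp add: symbolic_Rees_eq FA.lterm_mem_rees_iff FA.F_nonpos)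

lemma to_local_lterm: "to_local A q \<circ> lterm A a n = lterm (local_at A q) (to_local A q a) n"
  by (auto simp: lterm_def fun_eq_iff)

end

lemma (in Group.comm_monoid) Units_memI:
  "\<lbrakk>x \<in> carrier G; y \<in> carrier G; x \<otimes> y = \<one>\<rbrakk> \<Longrightarrow> x \<in> Units G"
  using m_comm by (auto simp: Units_def intro!: bexI[of _ y])

section \<open>Clearing denominators in \<open>G(A_q)\<close>\<close>

context prime_pair
begin

lemma symbolic_Rees_cring: "cring (symbolic_Rees A p)"
  unfolding symbolic_Rees_eq by (rule FA.rees_cring)

lemma symbolic_G_cring: "cring (symbolic_G A p q)"
  unfolding symbolic_G_eq by (rule FB.gr_cring)

lemma to_local_mult_fraction:
  assumes "a \<in> carrier A" "s \<in> carrier A - q"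
  shows "to_local A q s \<otimes>\<^bsub>local_at A q\<^esub> fraction A (carrier A - q) a s = to_local A q a"
proof -
  have "fraction A (carrier A - q) (s \<otimes> a) (\<one> \<otimes> s) = fraction A (carrier A - q) a \<one>"
    using assms S_one by (intro fraction_eqI) (simp_all add: m_comm)
  then show ?thesis
    using assms S_one by (simp add: to_local_def local_at_def localization_mult)
qed

lemma fraction_numerator:
  assumes "x \<in> carrier (local_at A q)"
  obtains a s where "a \<in> carrier A" "s \<in> carrier A - q" "to_local A q s \<otimes>\<^bsub>local_at A q\<^esub> x = to_local A q a"
    "x = fraction A (carrier A - q) a s"
proof -
  obtain a s where *: "a \<in> carrier A" "s \<in> carrier A - q" "x = fraction A (carrier A - q) a s"
    using assms unfolding local_at_def by (rule fraction_cases)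
  then show ?thesis using to_local_mult_fraction by (intro that) auto
qed

text \<open>Finiteness of the support enters here. A numerator stays in its symbolic power when the
  denominators of the other coefficients are multiplied in, as that power is an ideal.\<close>

lemma common_denominator_family:
  assumes "finite K" "\<And>n. n \<in> K \<Longrightarrow> g n \<in> symbolic_power (local_at A q) (local_ext A q p) n"
  shows "\<exists>s\<in>carrier A - q. \<forall>n\<in>K. \<exists>a\<in>symbolic_power A p n.
    to_local A q s \<otimes>\<^bsub>local_at A q\<^esub> g n = to_local A q a"
  using assms
proof (induct K)
  case empty
  then show ?case using S_one by blast
next
  case (insert m K)
  obtain s where s: "s \<in> carrier A - q"
    "\<And>n. n \<in> K \<Longrightarrow> \<exists>a\<in>symbolic_power A p n. to_local A q s \<otimes>\<^bsub>local_at A q\<^esub> g n = to_local A q a"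
    using insert(3)[OF insert(4)] by auto
  have gm: "g m \<in> symbolic_power (local_at A q) (local_ext A q p) m" by (rule insert(4)) simp
  obtain b t where b: "b \<in> carrier A" "t \<in> carrier A - q"
    "to_local A q t \<otimes>\<^bsub>local_at A q\<^esub> g m = to_local A q b" "g m = fraction A (carrier A - q) b t"
    using FB.F_carrier[OF gm] by (rule fraction_numerator)
  \<comment> \<open>A numerator of an element of the symbolic power of \<open>p A_q\<close> lies in
    that of \<open>p\<close>; for an arbitrary filtration of \<open>A_q\<close> this could
    fail.\<close>
  have "b \<in> symbolic_power A p m"
    using gm fraction_mem_symbolic_power_iff[OF q_prime p_prime p_sub_q b(1,2)] b(4) by simp
  have scale: "\<exists>a\<in>symbolic_power A p n. to_local A q (v \<otimes> u) \<otimes>\<^bsub>local_at A q\<^esub> g n = to_local A q a"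
    if "a \<in> symbolic_power A p n" "to_local A q u \<otimes>\<^bsub>local_at A q\<^esub> g n = to_local A q a"
      "u \<in> carrier A" "v \<in> carrier A" "g n \<in> carrier (local_at A q)" for a n u v
  proof
    show "v \<otimes> a \<in> symbolic_power A p n"
      using ideal.I_l_closed[OF FA.F_ideal that(1,4)] .
    have "to_local A q (v \<otimes> u) \<otimes>\<^bsub>local_at A q\<^esub> g n =
        to_local A q v \<otimes>\<^bsub>local_at A q\<^esub> (to_local A q u \<otimes>\<^bsub>local_at A q\<^esub> g n)"
      using that by (simp add: FB.m_assoc)
    then show "to_local A q (v \<otimes> u) \<otimes>\<^bsub>local_at A q\<^esub> g n = to_local A q (v \<otimes> a)"
      using that FA.F_carrier[OF that(1)] by simp
  qed
  have "\<exists>a\<in>symbolic_power A p n. to_local A q (s \<otimes> t) \<otimes>\<^bsub>local_at A q\<^esub> g n = to_local A q a"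
    if n: "n \<in> insert m K" for n
  proof (cases "n = m")
    case True
    then show ?thesis
      using scale[OF \<open>b \<in> symbolic_power A p m\<close> b(3)] b(2) s(1) FB.F_carrier[OF gm] by simp
  next
    case False
    then obtain a where "a \<in> symbolic_power A p n" "to_local A q s \<otimes>\<^bsub>local_at A q\<^esub> g n = to_local A q a"
      using s(2) n by blast
    then have "\<exists>a\<in>symbolic_power A p n. to_local A q (t \<otimes> s) \<otimes>\<^bsub>local_at A q\<^esub> g n = to_local A q a"
      using b(2) s(1) FB.F_carrier[OF insert(4)[OF n]] by (intro scale) auto
    then show ?thesis using b(2) s(1) by (simp add: m_comm)
  qed
  then show ?case using S_mult[OF s(1) b(2)] by blast
qed

lemma to_G_lterm_mult:
  assumes "a \<in> carrier A" "g \<in> carrier (rees (local_at A q) (symbolic_power (local_at A q) (local_ext A q p)))"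
  shows "to_G (lterm A a 0) \<otimes>\<^bsub>symbolic_G A p q\<^esub> FB.initial g =
    FB.initial (\<lambda>n. to_local A q a \<otimes>\<^bsub>local_at A q\<^esub> g n)"
proof -
  have "lterm (local_at A q) (to_local A q a) 0 \<in>
      carrier (rees (local_at A q) (symbolic_power (local_at A q) (local_ext A q p)))"
    using assms(1) by (simp add: FB.lterm_mem_rees_iff FB.F_nonpos)
  then have "to_G (lterm A a 0) \<otimes>\<^bsub>symbolic_G A p q\<^esub> FB.initial g =
      FB.initial (lterm (local_at A q) (to_local A q a) 0 \<otimes>\<^bsub>Laurent (local_at A q)\<^esub> g)"
    using assms(2) by (simp add: to_G_def to_local_lterm symbolic_G_eq FB.initial_mult)
  also have "lterm (local_at A q) (to_local A q a) 0 \<otimes>\<^bsub>Laurent (local_at A q)\<^esub> g =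
      (\<lambda>n. to_local A q a \<otimes>\<^bsub>local_at A q\<^esub> g n)"
    using assms by (simp add: FB.lterm_mult mem_rees_iff)
  finally show ?thesis .
qed

text \<open>Both main points are settled in the Rees ring of \<open>A_q\<close> and carried over by
  \<open>FB.initial\<close>: a constant from \<open>A - q\<close> is already a unit there, and an
  element of \<open>G(A_q)\<close> is lifted there to a Laurent polynomial whose finitely many
  denominators are cleared at once.\<close>

lemma localizing_hom_to_G:
  "localizing_hom (symbolic_Rees A p) (symbolic_G A p q) to_G units_set"
proof (intro localizing_hom.intro ring_hom_cring.intro ring_hom_cring_axioms.intro
    localizing_hom_axioms.intro symbolic_Rees_cring symbolic_G_cring to_G_hom)
  let ?RB = "rees (local_at A q) (symbolic_power (local_at A q) (local_ext A q p))"
  interpret RB: cring ?RB by (rule FB.rees_cring)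
  interpret init: ring_hom_cring ?RB FB.gr FB.initial
    by (intro ring_hom_cring.intro ring_hom_cring_axioms.intro FB.rees_cring FB.gr_cring FB.initial_hom)
  show "units_set \<subseteq> carrier (symbolic_Rees A p)"
    by (auto simp: units_set_def lterm_mem_symbolic_Rees)
  show "\<one>\<^bsub>symbolic_Rees A p\<^esub> \<in> units_set"
    using S_one by (simp add: units_set_def Laurent_one)
  show "s \<otimes>\<^bsub>symbolic_Rees A p\<^esub> t \<in> units_set" if "s \<in> units_set" "t \<in> units_set" for s t
  proof -
    from that obtain a b where "a \<in> carrier A - q" "b \<in> carrier A - q"
      "s = lterm A a 0" "t = lterm A b 0"
      unfolding units_set_def by blast
    then show ?thesis using S_mult[of a b] by (simp add: units_set_def lterm_mult_lterm)
  qed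
  show "to_G s \<in> Units (symbolic_G A p q)" if "s \<in> units_set" for s
  proof -
    from that obtain a where a: "a \<in> carrier A - q" "s = lterm A a 0"
      unfolding units_set_def by blast
    let ?x = "to_local A q a" and ?y = "fraction A (carrier A - q) \<one> a"
    have y: "?y \<in> carrier (local_at A q)" using a by (simp add: local_at_def)
    have x: "?x \<in> carrier (local_at A q)" using a by simp
    have xy: "?x \<otimes>\<^bsub>local_at A q\<^esub> ?y = \<one>\<^bsub>local_at A q\<^esub>"
      using fraction_mult_inverse[OF a(1)] by (simp add: to_local_def local_at_def)
    have "lterm (local_at A q) ?x 0 \<in> Units ?RB"
    proof (rule RB.Units_memI)
      show "lterm (local_at A q) ?x 0 \<in> carrier ?RB" "lterm (local_at A q) ?y 0 \<in> carrier ?RB"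
        using x y by (simp_all add: FB.lterm_mem_rees_iff FB.F_nonpos)
      show "lterm (local_at A q) ?x 0 \<otimes>\<^bsub>?RB\<^esub> lterm (local_at A q) ?y 0 = \<one>\<^bsub>?RB\<^esub>"
        using x y xy by (simp add: FB.lterm_mult_lterm FB.Laurent_one)
    qed
    from init.hom_Units[OF this] show ?thesis
      by (simp add: a(2) to_G_def to_local_lterm symbolic_G_eq)
  qed
  show "\<exists>s\<in>units_set. \<exists>r\<in>carrier (symbolic_Rees A p). to_G s \<otimes>\<^bsub>symbolic_G A p q\<^esub> y = to_G r"
    if "y \<in> carrier (symbolic_G A p q)" for y
  proof -
    from that obtain g where g: "g \<in> carrier ?RB" "y = FB.initial g"
      unfolding symbolic_G_eq FB.initial_image[symmetric] by blast
    then have g': "g \<in> carrier (Laurent (local_at A q))"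
      "\<And>n. g n \<in> symbolic_power (local_at A q) (local_ext A q p) n"
      by (simp_all add: mem_rees_iff)
    define K where "K = {n. g n \<noteq> \<zero>\<^bsub>local_at A q\<^esub>}"
    have K: "finite K" using FB.Laurent_finite[OF g'(1)] by (simp add: K_def)
    obtain s where s: "s \<in> carrier A - q"
      "\<And>n. n \<in> K \<Longrightarrow> \<exists>a\<in>symbolic_power A p n. to_local A q s \<otimes>\<^bsub>local_at A q\<^esub> g n = to_local A q a"
      using common_denominator_family[OF K g'(2)] by blast
    have "\<forall>n. \<exists>a. n \<in> K \<longrightarrow>
        a \<in> symbolic_power A p n \<and> to_local A q s \<otimes>\<^bsub>local_at A q\<^esub> g n = to_local A q a"
      using s(2) by blast
    from choice[OF this] obtain a where a: "\<And>n. n \<in> K \<Longrightarrow> a n \<in> symbolic_power A p n"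
      "\<And>n. n \<in> K \<Longrightarrow> to_local A q s \<otimes>\<^bsub>local_at A q\<^esub> g n = to_local A q (a n)"
      by blast
    \<comment> \<open>Off \<open>K\<close> the chosen \<open>a n\<close> is arbitrary; the value
      \<open>\<zero>\<close> gives finite support and is the right numerator, since
      \<open>g n\<close> vanishes there.\<close>
    define f where "f n = (if n \<in> K then a n else \<zero>)" for n
    have fF: "f n \<in> symbolic_power A p n" for n using a(1) FA.F_zero by (simp add: f_def)
    have "finite {n. f n \<noteq> \<zero>}"
      by (rule finite_subset[OF _ K]) (auto simp: f_def split: if_splits)
    then have f: "f \<in> carrier (symbolic_Rees A p)"
      unfolding symbolic_Rees_eq mem_rees_iff mem_Laurent_iff using fF FA.F_carrier[OF fF] by blast
    have "to_local A q s \<otimes>\<^bsub>local_at A q\<^esub> g n = to_local A q (f n)" for n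
      using a(2)[of n] s(1) by (cases "n \<in> K") (simp_all add: f_def, simp add: K_def)
    then have "to_G (lterm A s 0) \<otimes>\<^bsub>symbolic_G A p q\<^esub> y = to_G f"
      using to_G_lterm_mult[OF _ g(1), of s] s(1) by (simp add: g(2) to_G_def comp_def)
    then show ?thesis using f s(1) unfolding units_set_def by blast
  qed
qed

end

sublocale prime_pair \<subseteq> G: localizing_hom "symbolic_Rees A p" "symbolic_G A p q" to_G units_set
  by (rule localizing_hom_to_G)

context prime_pair
begin

section \<open>The kernel of \<open>to_G\<close>\<close>

lemma to_G_eq_zero_iff:
  assumes "f \<in> carrier (symbolic_Rees A p)"
  shows "to_G f = \<zero>\<^bsub>symbolic_G A p q\<^esub> \<longleftrightarrow> (\<forall>n. f (int n) \<in> symbolic_power A p (int (Suc n)))"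
proof -
  have f: "f n \<in> carrier A" for n using assms by (simp add: symbolic_Rees_eq mem_rees_iff)
  have "to_G f = \<zero>\<^bsub>symbolic_G A p q\<^esub> \<longleftrightarrow> (\<forall>n. FB.initial (to_local A q \<circ> f) n =
      symbolic_power (local_at A q) (local_ext A q p) (int (Suc n)))"
    by (simp add: to_G_def symbolic_G_eq assoc_graded_def fun_eq_iff)
  also have "\<dots> \<longleftrightarrow> (\<forall>n. f (int n) \<in> symbolic_power A p (int (Suc n)))"
    using f by (simp add: FB.initial_def FB.coset_eq_F_iff to_local_mem_iff)
  finally show ?thesis .
qed

lemma symbolic_Rees_t_inv: "lterm A \<one> (-1) \<in> carrier (symbolic_Rees A p)"
  by (simp add: lterm_mem_symbolic_Rees)

lemma to_G_t_inv: "to_G (lterm A \<one> (-1)) = \<zero>\<^bsub>symbolic_G A p q\<^esub>"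
  unfolding to_G_eq_zero_iff[OF symbolic_Rees_t_inv] using FA.F_zero by (simp add: lterm_def)

text \<open>An element \<open>f\<close> of the kernel has its coefficient of degree
  \<open>n - 1\<close> in the symbolic power \<open>n\<close> for \<open>n \<ge> 1\<close>, which
  says exactly that \<open>t f\<close> belongs to the Rees algebra again. Thus \<open>f\<close> is
  \<open>1/t\<close> times an element of that algebra; \<open>g\<close> below is \<open>t f\<close>,
  formed among the Laurent polynomials.\<close>

lemma kernel_to_G_subset_iff:
  assumes "ideal Q (symbolic_Rees A p)"
  shows "a_kernel (symbolic_Rees A p) (symbolic_G A p q) to_G \<subseteq> Q \<longleftrightarrow> lterm A \<one> (-1) \<in> Q"
proof
  assume "a_kernel (symbolic_Rees A p) (symbolic_G A p q) to_G \<subseteq> Q"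
  then show "lterm A \<one> (-1) \<in> Q"
    using to_G_t_inv symbolic_Rees_t_inv unfolding a_kernel_def' by blast
next
  interpret Q: ideal Q "symbolic_Rees A p" by fact
  assume t: "lterm A \<one> (-1) \<in> Q"
  show "a_kernel (symbolic_Rees A p) (symbolic_G A p q) to_G \<subseteq> Q"
  proof
    fix f assume "f \<in> a_kernel (symbolic_Rees A p) (symbolic_G A p q) to_G"
    then have f: "f \<in> carrier (symbolic_Rees A p)" "to_G f = \<zero>\<^bsub>symbolic_G A p q\<^esub>"
      unfolding a_kernel_def' by blast+
    have f': "f \<in> carrier (Laurent A)" using f(1) by (simp add: symbolic_Rees_eq mem_rees_iff)
    define g where "g = lterm A \<one> 1 \<otimes>\<^bsub>Laurent A\<^esub> f"
    have g: "g = (\<lambda>n. f (n - 1))" "g \<in> carrier (Laurent A)"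
      using f' lterm_mult_closed[OF one_closed f'] by (simp_all add: g_def lterm_mult)
    have "g n \<in> symbolic_power A p n" for n
    proof (cases "n \<le> 0")
      case True
      then show ?thesis using g(2) by (simp add: FA.F_nonpos)
    next
      case False
      then show ?thesis
        using f(2)[unfolded to_G_eq_zero_iff[OF f(1)], rule_format, of "nat (n - 1)"]
        by (simp add: g(1) of_nat_Suc)
    qed
    then have "g \<in> carrier (symbolic_Rees A p)" using g(2) by (simp add: symbolic_Rees_eq mem_rees_iff)
    then have "lterm A \<one> (-1) \<otimes>\<^bsub>Laurent A\<^esub> g \<in> Q" using Q.I_r_closed[OF t] by simp
    moreover have "lterm A \<one> (-1) \<otimes>\<^bsub>Laurent A\<^esub> g = f"
      using f' g(2) by (simp add: lterm_mult) (simp add: g(1))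
    ultimately show "f \<in> Q" by simp
  qed
qed

section \<open>Primes over \<open>(q, 1/t)\<close> and the ideal generated by
  \<open>q A_q / p A_q\<close>\<close>

lemma poly_t_inv_subset: "carrier (poly_t_inv A) \<subseteq> carrier (symbolic_Rees A p)"
proof
  fix f assume f: "f \<in> carrier (poly_t_inv A)"
  have "f n \<in> symbolic_power A p n" for n
    using f FA.F_zero by (cases "n \<le> 0") (simp_all add: mem_poly_t_inv_iff FA.F_nonpos)
  then show "f \<in> carrier (symbolic_Rees A p)"
    using f by (simp add: mem_poly_t_inv_iff symbolic_Rees_eq mem_rees_iff)
qed

text \<open>Modulo \<open>1/t\<close> each element of \<open>A[1/t]\<close> is its constant
  coefficient. Once \<open>1/t\<close> is in \<open>Q\<close>, the contraction of \<open>Q\<close>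
  is therefore determined by the constants that \<open>Q\<close> contains.\<close>

lemma contracts_to_q_t_inv_iff:
  assumes "ideal Q (symbolic_Rees A p)"
  shows "Q \<inter> carrier (poly_t_inv A) = q_t_inv A q \<longleftrightarrow>
    lterm A \<one> (-1) \<in> Q \<and> (\<forall>a\<in>q. lterm A a 0 \<in> Q) \<and> Q \<inter> units_set = {}"
proof -
  interpret Q: ideal Q "symbolic_Rees A p" by fact
  interpret q: primeideal q A by (rule q_prime)
  have eq: "q_t_inv A q = {f \<in> carrier (poly_t_inv A). f 0 \<in> q}" by (rule q_t_inv_eq) (rule q.is_ideal)
  have const: "lterm A a 0 \<in> q_t_inv A q \<longleftrightarrow> a \<in> q" if "a \<in> carrier A" for a
    unfolding eq using lterm_mem_poly_t_inv[OF that, of 0] by (simp add: lterm_def)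
  show ?thesis
  proof
    assume Q: "Q \<inter> carrier (poly_t_inv A) = q_t_inv A q"
    have "lterm A \<one> (-1) \<in> q_t_inv A q"
      unfolding eq using lterm_mem_poly_t_inv[OF one_closed, of "-1"] q.zero_closed
      by (simp add: lterm_def)
    moreover have "lterm A a 0 \<notin> Q" if "a \<in> carrier A - q" for a
      using that const[of a] lterm_mem_poly_t_inv[of a 0] Q by blast
    ultimately show "lterm A \<one> (-1) \<in> Q \<and> (\<forall>a\<in>q. lterm A a 0 \<in> Q) \<and> Q \<inter> units_set = {}"
      using Q const q.Icarr unfolding units_set_def by blast
  next
    assume *: "lterm A \<one> (-1) \<in> Q \<and> (\<forall>a\<in>q. lterm A a 0 \<in> Q) \<and> Q \<inter> units_set = {}"
    have "f \<in> Q \<longleftrightarrow> f 0 \<in> q" if f: "f \<in> carrier (poly_t_inv A)" for f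
    proof -
      obtain g where g: "g \<in> carrier (poly_t_inv A)"
        "f = lterm A (f 0) 0 \<oplus>\<^bsub>Laurent A\<^esub> lterm A \<one> (-1) \<otimes>\<^bsub>Laurent A\<^esub> g"
        using poly_t_inv_decompose[OF f] .
      define h where "h = lterm A \<one> (-1) \<otimes>\<^bsub>Laurent A\<^esub> g"
      have h: "h \<in> Q" using Q.I_r_closed[of "lterm A \<one> (-1)" g] * g(1) poly_t_inv_subset
        by (auto simp: h_def)
      have f0: "f 0 \<in> carrier A" using f by (simp add: mem_poly_t_inv_iff)
      have c: "lterm A (f 0) 0 \<in> carrier (symbolic_Rees A p)"
        using f0 by (simp add: lterm_mem_symbolic_Rees)
      have fh: "f = lterm A (f 0) 0 \<oplus>\<^bsub>symbolic_Rees A p\<^esub> h" using g(2) by (simp add: h_def)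
      have "f \<in> Q \<longleftrightarrow> lterm A (f 0) 0 \<in> Q"
      proof
        assume "f \<in> Q"
        then have "f \<ominus>\<^bsub>symbolic_Rees A p\<^esub> h \<in> Q" unfolding a_minus_def
          using h by (intro Q.a_closed Q.a_inv_closed)
        also have "f \<ominus>\<^bsub>symbolic_Rees A p\<^esub> h =
            lterm A (f 0) 0 \<oplus>\<^bsub>symbolic_Rees A p\<^esub> h \<ominus>\<^bsub>symbolic_Rees A p\<^esub> h"
          by (subst fh) simp
        also have "\<dots> = lterm A (f 0) 0"
          unfolding a_minus_def using c Q.Icarr[OF h]
          by (simp only: G.R.a_assoc G.R.r_neg G.R.a_inv_closed G.R.r_zero)
        finally show "lterm A (f 0) 0 \<in> Q" .
      next
        assume "lterm A (f 0) 0 \<in> Q"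
        then have "lterm A (f 0) 0 \<oplus>\<^bsub>symbolic_Rees A p\<^esub> h \<in> Q" using h by (rule Q.a_closed)
        then show "f \<in> Q" by (simp only: fh[symmetric])
      qed
      also have "\<dots> \<longleftrightarrow> f 0 \<in> q"
        using * f0 unfolding units_set_def by blast
      finally show ?thesis .
    qed
    then show "Q \<inter> carrier (poly_t_inv A) = q_t_inv A q" unfolding eq by blast
  qed
qed

text \<open>The generators are the initial forms of the constant Laurent polynomials with value in
  \<open>q A_q\<close>. These three facts are all that the later proofs use of the ideal.\<close>

lemma ideal_symbolic_G_ideal: "ideal (symbolic_G_ideal A p q) (symbolic_G A p q)"
  and symbolic_G_ideal_generator: "a \<in> q \<Longrightarrow> to_G (lterm A a 0) \<in> symbolic_G_ideal A p q"
  and symbolic_G_ideal_minimal: "\<lbrakk>ideal I (symbolic_G A p q);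
    \<And>x. x \<in> local_ext A q q \<Longrightarrow> FB.initial (lterm (local_at A q) x 0) \<in> I\<rbrakk> \<Longrightarrow> symbolic_G_ideal A p q \<subseteq> I"
proof -
  interpret q: primeideal q A by (rule q_prime)
  let ?X = "{(\<lambda>n. if n = 0 then symbolic_filtration A p q 1 +>\<^bsub>local_at A q\<^esub> a
          else symbolic_filtration A p q (Suc n)) | a. a \<in> local_ext A q q}"
  have ext: "local_ext A q q = ext q" by (rule local_ext_eq[OF q_prime q.is_ideal])
  have X: "?X = (\<lambda>x. FB.initial (lterm (local_at A q) x 0)) ` local_ext A q q"
  proof -
    have "(\<lambda>n. if n = 0 then symbolic_filtration A p q 1 +>\<^bsub>local_at A q\<^esub> x
          else symbolic_filtration A p q (Suc n)) = FB.initial (lterm (local_at A q) x 0)" for x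
      using FB.a_rcos_zero[OF FB.F_ideal FB.F_zero]
      by (auto simp: FB.initial_def fun_eq_iff symbolic_filtration_def lterm_def)
    then show ?thesis by auto
  qed
  have "ext q \<subseteq> carrier (local_at A q)" unfolding local_at_def by (rule ext_subset) (rule q.a_subset)
  then have sub: "?X \<subseteq> carrier (symbolic_G A p q)"
    unfolding X symbolic_G_eq FB.initial_image[symmetric]
    unfolding ext by (intro image_subsetI imageI) (auto simp: FB.lterm_mem_rees_iff FB.F_nonpos)
  show "ideal (symbolic_G_ideal A p q) (symbolic_G A p q)"
    unfolding symbolic_G_ideal_def by (rule G.S.genideal_ideal[OF sub])
  show "symbolic_G_ideal A p q \<subseteq> I" if "ideal I (symbolic_G A p q)"
    "\<And>x. x \<in> local_ext A q q \<Longrightarrow> FB.initial (lterm (local_at A q) x 0) \<in> I"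
    unfolding symbolic_G_ideal_def by (rule G.S.genideal_minimal[OF that(1)]) (unfold X, use that(2) in blast)
  show "to_G (lterm A a 0) \<in> symbolic_G_ideal A p q" if "a \<in> q"
  proof -
    have "to_local A q a \<in> local_ext A q q"
      unfolding ext to_local_def using that S_one by (rule fraction_mem_ext)
    then have "to_G (lterm A a 0) \<in> ?X" unfolding X to_G_def to_local_lterm by blast
    then show ?thesis unfolding symbolic_G_ideal_def using G.S.genideal_self[OF sub] by blast
  qed
qed

text \<open>For the forward direction \<open>symbolic_G_ideal\<close> is compared with the extension
  of \<open>Q\<close>, whose contraction is \<open>Q\<close>; by minimality it suffices to treat a
  generator given by \<open>a/s\<close>, and multiplying by the image of \<open>s\<close> turns it
  into the image of \<open>a \<in> q\<close>. Backwards, the contraction contains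
  \<open>1/t\<close>, which maps to zero, and the constants from \<open>q\<close>.\<close>

lemma relevant_quotient_iff:
  assumes "Q \<in> Spec (symbolic_Rees A p)"
  shows "Q \<inter> carrier (poly_t_inv A) = q_t_inv A q \<longleftrightarrow>
    G.contraction (symbolic_G_ideal A p q) \<subseteq> Q \<and> Q \<inter> units_set = {}"
proof -
  interpret Q: primeideal Q "symbolic_Rees A p" using assms by (simp add: Spec_def)
  interpret q: primeideal q A by (rule q_prime)
  note iff = contracts_to_q_t_inv_iff[OF Q.is_ideal]
  show ?thesis
  proof
    assume "Q \<inter> carrier (poly_t_inv A) = q_t_inv A q"
    then have *: "lterm A \<one> (-1) \<in> Q" "\<And>a. a \<in> q \<Longrightarrow> lterm A a 0 \<in> Q" "Q \<inter> units_set = {}"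
      unfolding iff by auto
    have rel: "Q \<in> G.relevant_Spec"
      using assms *(1,3) kernel_to_G_subset_iff[OF Q.is_ideal] unfolding G.relevant_Spec_def by blast
    have "symbolic_G_ideal A p q \<subseteq> G.extension Q"
    proof (rule symbolic_G_ideal_minimal[OF G.ideal_extension[OF Q.is_ideal]])
      fix x assume "x \<in> local_ext A q q"
      then have "x \<in> ext q" by (simp only: local_ext_eq[OF q_prime q.is_ideal])
      then obtain a s where a: "a \<in> q" "s \<in> carrier A - q" "x = fraction A (carrier A - q) a s"
        by (rule ext_cases)
      have x: "x \<in> carrier (local_at A q)" using a q.Icarr by (simp add: local_at_def)
      let ?g = "lterm (local_at A q) x 0"
      have g: "?g \<in> carrier (rees (local_at A q) (symbolic_power (local_at A q) (local_ext A q p)))"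
        using x by (simp add: FB.lterm_mem_rees_iff FB.F_nonpos)
      have sx: "to_local A q s \<otimes>\<^bsub>local_at A q\<^esub> x = to_local A q a"
        unfolding a(3) by (rule to_local_mult_fraction[OF q.Icarr[OF a(1)] a(2)])
      have "(\<lambda>n. to_local A q s \<otimes>\<^bsub>local_at A q\<^esub> ?g n) = to_local A q \<circ> lterm A a 0"
        using sx a(2) by (auto simp: lterm_def fun_eq_iff)
      then have "to_G (lterm A s 0) \<otimes>\<^bsub>symbolic_G A p q\<^esub> FB.initial ?g = to_G (lterm A a 0)"
        using to_G_lterm_mult[OF _ g, of s] a(2) by (simp add: to_G_def)
      moreover have "FB.initial ?g \<in> carrier (symbolic_G A p q)"
        using g FB.initial_image unfolding symbolic_G_eq by blast
      moreover have "lterm A s 0 \<in> units_set" using a(2) by (simp add: units_set_def)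
      ultimately show "FB.initial ?g \<in> G.extension Q"
        using *(2)[OF a(1)] by (intro G.mem_extensionI)
    qed
    then have "G.contraction (symbolic_G_ideal A p q) \<subseteq> G.contraction (G.extension Q)"
      unfolding G.contraction_def by blast
    then show "G.contraction (symbolic_G_ideal A p q) \<subseteq> Q \<and> Q \<inter> units_set = {}"
      using *(3) by (simp add: G.contraction_extension[OF rel])
  next
    assume *: "G.contraction (symbolic_G_ideal A p q) \<subseteq> Q \<and> Q \<inter> units_set = {}"
    have "lterm A \<one> (-1) \<in> G.contraction (symbolic_G_ideal A p q)"
      using symbolic_Rees_t_inv to_G_t_inv
        additive_subgroup.zero_closed[OF ideal.axioms(1)[OF ideal_symbolic_G_ideal]]
      by (simp add: G.contraction_def)
    moreover have "lterm A a 0 \<in> G.contraction (symbolic_G_ideal A p q)" if "a \<in> q" for a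
      using symbolic_G_ideal_generator[OF that] q.Icarr[OF that]
      by (simp add: G.contraction_def lterm_mem_symbolic_Rees)
    ultimately show "Q \<inter> carrier (poly_t_inv A) = q_t_inv A q" unfolding iff using * by blast
  qed
qed

theorem Spec_fibre_isomorphic:
  "inclusion_isomorphic
    {Q \<in> Spec (symbolic_Rees A p). Q \<inter> carrier (poly_t_inv A) = q_t_inv A q}
    (Spec (symbolic_G A p q Quot symbolic_G_ideal A p q))"
proof -
  let ?J = "symbolic_G_ideal A p q"
  interpret J: localizing_hom "symbolic_Rees A p" "symbolic_G A p q Quot ?J"
      "(+>\<^bsub>symbolic_G A p q\<^esub>) ?J \<circ> to_G" units_set
    by (rule G.localizing_hom_quotient[OF ideal_symbolic_G_ideal])
  \<comment> \<open>The kernel of the composite map is the contraction of \<open>?J\<close>, so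
    \<open>relevant_quotient_iff\<close> is precisely the description of
    \<open>J.relevant_Spec\<close>.\<close>
  have "{Q \<in> Spec (symbolic_Rees A p). Q \<inter> carrier (poly_t_inv A) = q_t_inv A q} = J.relevant_Spec"
    unfolding J.relevant_Spec_def G.a_kernel_quotient[OF ideal_symbolic_G_ideal]
    using relevant_quotient_iff by blast
  then show ?thesis using J.inclusion_isomorphic_Spec by simp
qed

lemma Spec_fibre_isomorphic_self:
  assumes "q = p"
  shows "inclusion_isomorphic
    {P \<in> Spec (symbolic_Rees A p). P \<inter> carrier (poly_t_inv A) = q_t_inv A q}
    (Spec (symbolic_G A p q))"
proof -
  interpret p: primeideal p A by (rule p_prime)
  have p1: "a \<in> symbolic_power A p 1" if "a \<in> p" for a
  proof -
    interpret M: comm_monoid "ideals_set A" by (rule ideals_set_is_comm_monoid)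
    have "p [^]\<^bsub>ideals_set A\<^esub> nat 1 = p"
      using M.nat_pow_eone[of p] p.is_ideal by (simp add: ideals_set_def)
    moreover have "\<one> \<otimes> a \<in> p" using that p.Icarr by simp
    ultimately show ?thesis
      unfolding mem_symbolic_power_iff[OF p_prime] using that p.Icarr S_one assms by blast
  qed
  have kernel: "lterm A a 0 \<in> a_kernel (symbolic_Rees A p) (symbolic_G A p q) to_G" if "a \<in> q" for a
  proof -
    have a: "a \<in> p" using that assms by simp
    have c: "lterm A a 0 \<in> carrier (symbolic_Rees A p)"
      using p.Icarr[OF a] by (simp add: lterm_mem_symbolic_Rees)
    \<comment> \<open>Only degree 0 carries a condition, namely that \<open>a\<close> lies in the
      first symbolic power; the other coefficients are zero.\<close>
    have "lterm A a 0 (int n) \<in> symbolic_power A p (int (Suc n))" for n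
      using p1[OF a] FA.F_zero by (cases n) (simp_all add: lterm_def of_nat_Suc)
    then have "to_G (lterm A a 0) = \<zero>\<^bsub>symbolic_G A p q\<^esub>" unfolding to_G_eq_zero_iff[OF c] by blast
    then show ?thesis unfolding a_kernel_def' using c by blast
  qed
  have "Q \<inter> carrier (poly_t_inv A) = q_t_inv A q \<longleftrightarrow>
    a_kernel (symbolic_Rees A p) (symbolic_G A p q) to_G \<subseteq> Q \<and> Q \<inter> units_set = {}"
    if "Q \<in> Spec (symbolic_Rees A p)" for Q
  proof -
    interpret Q: primeideal Q "symbolic_Rees A p" using that by (simp add: Spec_def)
    show ?thesis
      unfolding contracts_to_q_t_inv_iff[OF Q.is_ideal]
      using kernel_to_G_subset_iff[OF Q.is_ideal] kernel by blast
  qed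
  then have "{P \<in> Spec (symbolic_Rees A p). P \<inter> carrier (poly_t_inv A) = q_t_inv A q} = G.relevant_Spec"
    unfolding G.relevant_Spec_def by blast
  then show ?thesis using G.inclusion_isomorphic_Spec by simp
qed

end

theorem theorem3p2:
  fixes A :: "('a, 'b) ring_scheme" and p q :: "'a set"
  assumes "domain A" and "primeideal p A" and "primeideal q A" and "p \<subseteq> q"
  shows "inclusion_isomorphic
           {Q \<in> Spec (symbolic_Rees A p). Q \<inter> carrier (poly_t_inv A) = q_t_inv A q}
           (Spec (symbolic_G A p q Quot symbolic_G_ideal A p q))
       \<and> inclusion_isomorphic
           {P \<in> Spec (symbolic_Rees A p). P \<inter> carrier (poly_t_inv A) = q_t_inv A p}
           (Spec (symbolic_G A p p))"
proof
  show "inclusion_isomorphic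
      {Q \<in> Spec (symbolic_Rees A p). Q \<inter> carrier (poly_t_inv A) = q_t_inv A q}
      (Spec (symbolic_G A p q Quot symbolic_G_ideal A p q))"
    by (rule prime_pair.Spec_fibre_isomorphic) (intro prime_pair.intro assms)
  show "inclusion_isomorphic
      {P \<in> Spec (symbolic_Rees A p). P \<inter> carrier (poly_t_inv A) = q_t_inv A p}
      (Spec (symbolic_G A p p))"
    by (rule prime_pair.Spec_fibre_isomorphic_self) (intro prime_pair.intro assms order_refl refl)+
qed

end
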